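(* Let $\alpha\ge 3$ be a computable ordinal. There is no countable $\boldsymbol{\Sigma}^0_\alpha$ colouring of the directed graph $L_\alpha$ on $\mathbb{W}_\alpha$.
   Context: The tree. The computable ordinal $\alpha\ge 3$ is identified with a computable well-ordering of a computable subset of $\mathbb{N}$ whose successor relation and set of limit points are computable; this gives, uniformly for each limit $\delta\le\alpha$, a computable increasing sequence $(\delta_k)$ cofinal in $\delta$; it is assumed that every $\delta_k$ is a successor of a successor ordinal. $T_\alpha\subset \mathbb{N}^{<\omega}$ is the computable well-founded tree, with computable rank function $\mathrm{rk}$, defined as follows: the root $\langle\rangle$ is in $T_\alpha$ and has rank $\alpha$; if $\sigma\in T_\alpha$ has limit rank $\delta$ then for all $k$, $\sigma^\frown k\in T_\alpha$ and has rank $\delta_k$; if $\sigma\in T_\alpha$ has rank $\beta+1$ then for all $k$, $\sigma^\frown k\in T_\alpha$ and has rank $\beta$; nodes of rank $0$ are leaves. (So no node of height $\le 2$ is a leaf.) $\mathcal{L}_\alpha$ is the set of leaves. $2^{\mathcal{L}_\alpha}$ carries the product topology. Labelling. For $x\in 2^{\mathcal{L}_\alpha}$, $T^x\colon T_\alpha\to\{0,1\}$ is defined by recursion: $T^x(\sigma)=x(\sigma)$ for leaves $\sigma$; for $\sigma$ not a leaf, $T^x(\sigma)=0$ iff there is some $k$ with $T^x(\sigma^\frown k)=1$. Write $T^x(m)=T^x(\langle m\rangle)$, $T^x(m,k)=T^x(\langle m,k\rangle)$. For $x\in 2^{\mathcal{L}_\alpha}$ let $n^x=\sup\{n : (\forall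 m<n)\ T^x(m)=0\}\in\omega\cup\{\omega\}$, and for $m<n^x$ let $k^x(m)$ be the least $k$ such that $T^x(m,k)=1$. Coding. $(M_k)_{k\in\mathbb{N}}$ is a fixed uniformly computable, dense list of elements of Cantor space $2^\omega$. A number $k$ codes a finite binary string $\zeta$ if $\zeta\prec M_k$ ($\zeta$ is an initial segment of $M_k$). Graphs. $\mathbb{X}_\alpha=2^{\mathcal{L}_\alpha}\times \mathcal{P}(\mathbb{N})$, with subsets of $\mathbb{N}$ identified with their characteristic functions. $K_\alpha$ is the directed graph on $\mathbb{X}_\alpha$ with an edge from $(x,y)$ to $(x',y')$ iff $x'=x$, $T^x(\langle\rangle)=0$, $y\bigtriangleup y'=\{n^x\}$ and $n^x\notin y$ (when $T^x(\langle\rangle)=0$, $n^x$ is the least $n$ with $T^x(n)=1$). $\mathbb{W}_\alpha$ is the set of $(x,y)\in\mathbb{X}_\alpha$ such that for all $m<n^x$, $k^x(m)$ codes $y\restriction(m+1)$; it carries the subspace topology. $L_\alpha$ is the restriction of $K_\alpha$ to $\mathbb{W}_\alpha$. A countable $\boldsymbol{\Sigma}^0_\alpha$ colouring of a directed graph is a partition of the space into countably many $\boldsymbol{\Sigma}^0_\alpha$ sets (of that space), none of which contains both endpoints of an edge. *)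

theory Defs
  imports "HOL-Analysis.Analysis" "HOL-Library.Extended_Nat"
begin

text \<open>
  Total recursive functions of arity \<open>n\<close>, as functions on argument lists of length \<open>n\<close>.
  Minimisation is applied to regular functions only; by Kleene's normal form theorem the
  functions obtained in this way are exactly the total computable ones.
\<close>

inductive recfn :: "nat \<Rightarrow> (nat list \<Rightarrow> nat) \<Rightarrow> bool" where
  zero: "recfn n (\<lambda>xs. 0)"
| suc: "recfn 1 (\<lambda>xs. Suc (xs ! 0))"
| proj: "i < n \<Longrightarrow> recfn n (\<lambda>xs. xs ! i)"
| comp: "recfn (length gs) f \<Longrightarrow> (\<forall>g\<in>set gs. recfn n g) \<Longrightarrow>
    recfn n (\<lambda>xs. f (map (\<lambda>g. g xs) gs))"
| prec: "recfn n f \<Longrightarrow> recfn (Suc (Suc n)) g \<Longrightarrow>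
    recfn (Suc n) (\<lambda>xs. rec_nat (f (tl xs)) (\<lambda>k v. g (k # v # tl xs)) (hd xs))"
| mu: "recfn (Suc n) f \<Longrightarrow> (\<forall>xs. length xs = n \<longrightarrow> (\<exists>k. f (k # xs) = 0)) \<Longrightarrow>
    recfn n (\<lambda>xs. LEAST k. f (k # xs) = 0)"

definition computable_fun2 :: "(nat \<Rightarrow> nat \<Rightarrow> nat) \<Rightarrow> bool" where
  "computable_fun2 f \<longleftrightarrow> (\<exists>g. recfn 2 g \<and> (\<forall>a b. f a b = g [a, b]))"

definition computable_set :: "nat set \<Rightarrow> bool" where
  "computable_set A \<longleftrightarrow> (\<exists>g. recfn 1 g \<and> (\<forall>a. g [a] = (if a \<in> A then 1 else 0)))"

definition computable_rel :: "nat rel \<Rightarrow> bool" where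
  "computable_rel R \<longleftrightarrow> (\<exists>g. recfn 2 g \<and> (\<forall>a b. g [a, b] = (if (a, b) \<in> R then 1 else 0)))"


text \<open>
  An ordinal \<open>\<alpha>\<close> is given by a (reflexive) well-order \<open>r\<close> on a set of natural numbers.
  The ordinals \<open>\<beta> \<le> \<alpha>\<close> are represented by elements of \<^typ>\<open>nat option\<close>: \<open>Some a\<close>, for
  \<open>a \<in> Field r\<close>, is the order type of the strict predecessors of \<open>a\<close>, and \<open>None\<close> is \<open>\<alpha>\<close>
  itself. \<open>olt r\<close> is the strict order of these ordinals.
\<close>

definition olt :: "nat rel \<Rightarrow> nat option rel" where
  "olt r = {(Some a, Some b) | a b. (a, b) \<in> r \<and> a \<noteq> b} \<union> {(Some a, None) | a. a \<in> Field r}"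

definition ords :: "nat rel \<Rightarrow> nat option set" where
  "ords r = insert None (Some ` Field r)"

definition ord_zero :: "nat rel \<Rightarrow> nat option \<Rightarrow> bool" where
  "ord_zero r \<beta> \<longleftrightarrow> \<beta> \<in> ords r \<and> (\<forall>\<xi>. (\<xi>, \<beta>) \<notin> olt r)"

text \<open>\<open>ord_succ r \<beta> \<gamma>\<close> says \<open>\<gamma> = \<beta> + 1\<close>.\<close>

definition ord_succ :: "nat rel \<Rightarrow> nat option \<Rightarrow> nat option \<Rightarrow> bool" where
  "ord_succ r \<beta> \<gamma> \<longleftrightarrow> (\<beta>, \<gamma>) \<in> olt r \<and> \<not> (\<exists>\<xi>. (\<beta>, \<xi>) \<in> olt r \<and> (\<xi>, \<gamma>) \<in> olt r)"

definition ord_limit :: "nat rel \<Rightarrow> nat option \<Rightarrow> bool" where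
  "ord_limit r \<delta> \<longleftrightarrow> \<delta> \<in> ords r \<and> \<not> ord_zero r \<delta> \<and> \<not> (\<exists>\<beta>. ord_succ r \<beta> \<delta>)"

definition computable_ordinal :: "nat rel \<Rightarrow> bool" where
  "computable_ordinal r \<longleftrightarrow>
     Well_order r \<and> computable_set (Field r) \<and> computable_rel r \<and>
     computable_rel {(a, b). ord_succ r (Some a) (Some b)} \<and>
     computable_set {a. ord_limit r (Some a)}"

text \<open>
  \<open>fs \<delta> k\<close> is (the element of \<open>Field r\<close> representing) \<open>\<delta>\<^sub>k\<close>; its values for non-limit \<open>\<delta>\<close> are
  irrelevant. The sequences are uniformly computable, where \<open>Some a\<close> is coded by \<open>a + 1\<close> and
  the top element \<open>None\<close> by \<open>0\<close>.
\<close>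

definition fundamental_sequences :: "nat rel \<Rightarrow> (nat option \<Rightarrow> nat \<Rightarrow> nat) \<Rightarrow> bool" where
  "fundamental_sequences r fs \<longleftrightarrow>
     (\<exists>g. computable_fun2 g \<and>
        (\<forall>\<delta> k. ord_limit r \<delta> \<longrightarrow> fs \<delta> k = g (case \<delta> of None \<Rightarrow> 0 | Some a \<Rightarrow> Suc a) k)) \<and>
     (\<forall>\<delta>. ord_limit r \<delta> \<longrightarrow>
        (\<forall>k. (Some (fs \<delta> k), \<delta>) \<in> olt r) \<and>
        (\<forall>k. (Some (fs \<delta> k), Some (fs \<delta> (Suc k))) \<in> olt r) \<and>
        (\<forall>\<beta>. (\<beta>, \<delta>) \<in> olt r \<longrightarrow> (\<exists>k. (\<beta>, Some (fs \<delta> k)) \<in> olt r)) \<and>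
        (\<forall>k. \<exists>\<beta> \<gamma>. ord_succ r \<beta> \<gamma> \<and> ord_succ r \<gamma> (Some (fs \<delta> k))))"


text \<open>\<open>tree_rank r fs \<sigma> \<rho>\<close> says that \<open>\<sigma> \<in> T\<^sub>\<alpha>\<close> and \<open>rk \<sigma> = \<rho>\<close>.\<close>

inductive tree_rank ::
    "nat rel \<Rightarrow> (nat option \<Rightarrow> nat \<Rightarrow> nat) \<Rightarrow> nat list \<Rightarrow> nat option \<Rightarrow> bool"
  for r fs where
  root: "tree_rank r fs [] None"
| limit: "tree_rank r fs \<sigma> \<delta> \<Longrightarrow> ord_limit r \<delta> \<Longrightarrow> tree_rank r fs (\<sigma> @ [k]) (Some (fs \<delta> k))"
| succ: "tree_rank r fs \<sigma> \<gamma> \<Longrightarrow> ord_succ r \<beta> \<gamma> \<Longrightarrow> tree_rank r fs (\<sigma> @ [k]) \<beta>"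

definition tree :: "nat rel \<Rightarrow> (nat option \<Rightarrow> nat \<Rightarrow> nat) \<Rightarrow> nat list set" where
  "tree r fs = {\<sigma>. \<exists>\<rho>. tree_rank r fs \<sigma> \<rho>}"

definition leaves :: "nat rel \<Rightarrow> (nat option \<Rightarrow> nat \<Rightarrow> nat) \<Rightarrow> nat list set" where
  "leaves r fs = {\<sigma>. \<exists>\<rho>. tree_rank r fs \<sigma> \<rho> \<and> ord_zero r \<rho>}"

text \<open>
  Throughout, the bits \<open>0\<close> and \<open>1\<close> are \<^const>\<open>False\<close> and \<^const>\<open>True\<close>. \<open>label r fs x\<close> is the
  labelling \<open>T\<^sup>x\<close>, defined by recursion along the child relation of the tree; the recursion
  equations are \<open>label_leaf\<close> and \<open>label_inner\<close> below.
\<close>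

definition child_rel :: "nat rel \<Rightarrow> (nat option \<Rightarrow> nat \<Rightarrow> nat) \<Rightarrow> nat list rel" where
  "child_rel r fs = {(\<sigma> @ [k], \<sigma>) | \<sigma> k. \<sigma> \<in> tree r fs \<and> \<sigma> @ [k] \<in> tree r fs}"

definition label ::
    "nat rel \<Rightarrow> (nat option \<Rightarrow> nat \<Rightarrow> nat) \<Rightarrow> (nat list \<Rightarrow> bool) \<Rightarrow> nat list \<Rightarrow> bool" where
  "label r fs x = wfrec (child_rel r fs)
     (\<lambda>t \<sigma>. if \<sigma> \<in> leaves r fs then x \<sigma> else \<not> (\<exists>k. t (\<sigma> @ [k])))"

lemma wf_olt:
  assumes "Well_order r"
  shows "wf (olt r)"
proof -
  have "wf (r - Id)" using assms by (simp add: well_order_on_def)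
  then have "wf (inv_image (less_than <*lex*> (r - Id))
      (\<lambda>\<beta>. case \<beta> of None \<Rightarrow> (1::nat, 0) | Some a \<Rightarrow> (0, a)))"
    by (intro wf_inv_image wf_lex_prod wf_less_than)
  then show ?thesis
    by (rule wf_subset) (auto simp: olt_def inv_image_def)
qed

lemma ord_succ_unique:
  assumes "Well_order r" "ord_succ r \<beta> \<gamma>" "ord_succ r \<beta>' \<gamma>"
  shows "\<beta> = \<beta>'"
proof (rule ccontr)
  assume neq: "\<beta> \<noteq> \<beta>'"
  have lt: "(\<beta>, \<gamma>) \<in> olt r" "(\<beta>', \<gamma>) \<in> olt r"
    using assms by (auto simp: ord_succ_def)
  have tot: "total_on (Field r) r"
    using assms(1) by (simp add: well_order_on_def linear_order_on_def)
  obtain a b where ab: "\<beta> = Some a" "\<beta>' = Some b" "a \<in> Field r" "b \<in> Field r"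
    using lt by (auto simp: olt_def Field_def)
  then have "(a, b) \<in> r \<or> (b, a) \<in> r"
    using tot neq by (auto simp: total_on_def)
  then have "(\<beta>, \<beta>') \<in> olt r \<or> (\<beta>', \<beta>) \<in> olt r"
    using ab neq by (auto simp: olt_def)
  then show False using assms lt by (meson ord_succ_def)
qed

lemma tree_rank_unique:
  assumes "Well_order r"
  shows "tree_rank r fs \<sigma> \<rho> \<Longrightarrow> tree_rank r fs \<sigma> \<rho>' \<Longrightarrow> \<rho> = \<rho>'"
proof (induction arbitrary: \<rho>' rule: tree_rank.induct)
  case root
  then show ?case by cases auto
next
  case (limit \<sigma> \<delta> k)
  from limit.prems show ?case
  proof cases
    case lim': (limit \<sigma>' \<delta>' k')
    then show ?thesis using limit.IH by simp
  next
    case (succ \<sigma>' \<gamma>' k')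
    then show ?thesis using limit.IH limit.hyps by (auto simp: ord_limit_def)
  qed simp
next
  case (succ \<sigma> \<gamma> \<beta> k)
  from succ.prems show ?case
  proof cases
    case (limit \<sigma>' \<delta>' k')
    then show ?thesis using succ.IH succ.hyps by (auto simp: ord_limit_def)
  next
    case succ': (succ \<sigma>' \<gamma>' k')
    then show ?thesis using succ.IH succ.hyps ord_succ_unique[OF assms] by simp
  qed simp
qed

lemma wf_child_rel:
  assumes "Well_order r" "fundamental_sequences r fs"
  shows "wf (child_rel r fs)"
proof -
  define rk where "rk \<sigma> = (THE \<rho>. tree_rank r fs \<sigma> \<rho>)" for \<sigma>
  have rk: "rk \<sigma> = \<rho>" if "tree_rank r fs \<sigma> \<rho>" for \<sigma> \<rho>
    using that tree_rank_unique[OF assms(1)] unfolding rk_def by blast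
  have "(rk (\<sigma> @ [k]), rk \<sigma>) \<in> olt r" if "\<sigma> @ [k] \<in> tree r fs" for \<sigma> k
  proof -
    from that obtain \<rho> where \<rho>: "tree_rank r fs (\<sigma> @ [k]) \<rho>" by (auto simp: tree_def)
    then show ?thesis
      by cases (use rk[OF \<rho>] rk assms(2) in \<open>auto simp: ord_succ_def fundamental_sequences_def\<close>)
  qed
  then have "child_rel r fs \<subseteq> inv_image (olt r) rk"
    by (auto simp: child_rel_def inv_image_def)
  then show ?thesis
    using wf_subset wf_inv_image[OF wf_olt[OF assms(1)]] by blast
qed

lemma label_rec:
  assumes "Well_order r" "fundamental_sequences r fs"
  shows "label r fs x \<sigma> = (if \<sigma> \<in> leaves r fs then x \<sigma>
    else \<not> (\<exists>k. cut (label r fs x) (child_rel r fs) \<sigma> (\<sigma> @ [k])))"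
  unfolding label_def by (rule wfrec[OF wf_child_rel[OF assms]])

lemma label_leaf:
  assumes "Well_order r" "fundamental_sequences r fs" "\<sigma> \<in> leaves r fs"
  shows "label r fs x \<sigma> = x \<sigma>"
  using label_rec[OF assms(1,2), of x \<sigma>] assms(3) by simp

lemma label_inner:
  assumes "Well_order r" "fundamental_sequences r fs" "\<sigma> \<in> tree r fs" "\<sigma> \<notin> leaves r fs"
  shows "label r fs x \<sigma> = False \<longleftrightarrow> (\<exists>k. label r fs x (\<sigma> @ [k]) = True)"
proof -
  obtain \<rho> where \<rho>: "tree_rank r fs \<sigma> \<rho>" using assms(3) by (auto simp: tree_def)
  have lt_ords: "\<beta> \<in> ords r" if "(\<beta>, \<gamma>) \<in> olt r" for \<beta> \<gamma>
    using that by (auto simp: ords_def olt_def Field_def)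
  have "\<rho> \<in> ords r" using \<rho>
  proof cases
    case root
    then show ?thesis by (simp add: ords_def)
  next
    case (limit \<sigma> \<delta> k)
    then have "(\<rho>, \<delta>) \<in> olt r" using assms(2) by (simp add: fundamental_sequences_def)
    then show ?thesis by (rule lt_ords)
  next
    case (succ \<sigma> \<gamma> k)
    then have "(\<rho>, \<gamma>) \<in> olt r" by (simp add: ord_succ_def)
    then show ?thesis by (rule lt_ords)
  qed
  moreover have "\<not> ord_zero r \<rho>" using \<rho> assms(4) by (auto simp: leaves_def)
  ultimately have "ord_limit r \<rho> \<or> (\<exists>\<beta>. ord_succ r \<beta> \<rho>)"
    unfolding ord_limit_def by fast
  then have "\<sigma> @ [k] \<in> tree r fs" for k
    using tree_rank.limit[OF \<rho>] tree_rank.succ[OF \<rho>] by (force simp: tree_def)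
  then have "(\<sigma> @ [k], \<sigma>) \<in> child_rel r fs" for k
    using assms(3) by (auto simp: child_rel_def)
  then show ?thesis
    using label_rec[OF assms(1,2), of x \<sigma>] assms(4) by (simp add: cut_apply)
qed


definition cantor_space :: "(nat \<Rightarrow> bool) topology" where
  "cantor_space = product_topology (\<lambda>_. discrete_topology UNIV) UNIV"

text \<open>
  The points of the first factor are functions on the leaves, extended by \<^const>\<open>undefined\<close> to
  all of \<^typ>\<open>nat list\<close>; subsets of \<open>\<nat>\<close> are represented by their characteristic functions.
\<close>

definition space_X ::
    "nat rel \<Rightarrow> (nat option \<Rightarrow> nat \<Rightarrow> nat) \<Rightarrow> ((nat list \<Rightarrow> bool) \<times> (nat \<Rightarrow> bool)) topology" where
  "space_X r fs =
     prod_topology (product_topology (\<lambda>_. discrete_topology UNIV) (leaves r fs)) cantor_space"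

definition n_sup ::
    "nat rel \<Rightarrow> (nat option \<Rightarrow> nat \<Rightarrow> nat) \<Rightarrow> (nat list \<Rightarrow> bool) \<Rightarrow> enat" where
  "n_sup r fs x = Sup (enat ` {n. \<forall>m<n. label r fs x [m] = False})"

definition k_least ::
    "nat rel \<Rightarrow> (nat option \<Rightarrow> nat \<Rightarrow> nat) \<Rightarrow> (nat list \<Rightarrow> bool) \<Rightarrow> nat \<Rightarrow> nat" where
  "k_least r fs x m = (LEAST k. label r fs x [m, k] = True)"

definition uniformly_computable :: "(nat \<Rightarrow> nat \<Rightarrow> bool) \<Rightarrow> bool" where
  "uniformly_computable M \<longleftrightarrow> computable_rel {(k, i). M k i}"

definition dense_list :: "(nat \<Rightarrow> nat \<Rightarrow> bool) \<Rightarrow> bool" where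
  "dense_list M \<longleftrightarrow> cantor_space closure_of (range M) = topspace cantor_space"

definition restr :: "(nat \<Rightarrow> bool) \<Rightarrow> nat \<Rightarrow> bool list" where
  "restr y n = map y [0..<n]"

definition codes :: "(nat \<Rightarrow> nat \<Rightarrow> bool) \<Rightarrow> nat \<Rightarrow> bool list \<Rightarrow> bool" where
  "codes M k \<zeta> \<longleftrightarrow> \<zeta> = restr (M k) (length \<zeta>)"

definition graph_K ::
    "nat rel \<Rightarrow> (nat option \<Rightarrow> nat \<Rightarrow> nat) \<Rightarrow> ((nat list \<Rightarrow> bool) \<times> (nat \<Rightarrow> bool)) rel" where
  "graph_K r fs =
     {((x, y), (x', y')). (x, y) \<in> topspace (space_X r fs) \<and> (x', y') \<in> topspace (space_X r fs) \<and>
        x' = x \<and> label r fs x [] = False \<and>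
        (\<exists>n. n_sup r fs x = enat n \<and> sym_diff {i. y i} {i. y' i} = {n} \<and> n \<notin> {i. y i})}"

definition set_W ::
    "nat rel \<Rightarrow> (nat option \<Rightarrow> nat \<Rightarrow> nat) \<Rightarrow> (nat \<Rightarrow> nat \<Rightarrow> bool) \<Rightarrow>
     ((nat list \<Rightarrow> bool) \<times> (nat \<Rightarrow> bool)) set" where
  "set_W r fs M =
     {(x, y) \<in> topspace (space_X r fs).
        \<forall>m. enat m < n_sup r fs x \<longrightarrow> codes M (k_least r fs x m) (restr y (m + 1))}"

definition space_W ::
    "nat rel \<Rightarrow> (nat option \<Rightarrow> nat \<Rightarrow> nat) \<Rightarrow> (nat \<Rightarrow> nat \<Rightarrow> bool) \<Rightarrow>
     ((nat list \<Rightarrow> bool) \<times> (nat \<Rightarrow> bool)) topology" where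
  "space_W r fs M = subtopology (space_X r fs) (set_W r fs M)"

definition graph_L ::
    "nat rel \<Rightarrow> (nat option \<Rightarrow> nat \<Rightarrow> nat) \<Rightarrow> (nat \<Rightarrow> nat \<Rightarrow> bool) \<Rightarrow>
     ((nat list \<Rightarrow> bool) \<times> (nat \<Rightarrow> bool)) rel" where
  "graph_L r fs M = Restr (graph_K r fs) (set_W r fs M)"


text \<open>
  The boldface Borel hierarchy of a topological space: \<open>Sigma0 r X \<gamma> A\<close> says that \<open>A\<close> is
  \<open>\<Sigma>\<^sup>0\<^sub>\<gamma>\<close> in \<open>X\<close>, for \<open>1 \<le> \<gamma> \<le> \<alpha>\<close> in the representation above. \<open>\<Sigma>\<^sup>0\<^sub>1\<close> sets are the open sets,
  and for \<open>\<gamma> > 1\<close> the \<open>\<Sigma>\<^sup>0\<^sub>\<gamma>\<close> sets are the countable unions of sets whose complements are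
  \<open>\<Sigma>\<^sup>0\<^sub>\<beta>\<close> for some \<open>1 \<le> \<beta> < \<gamma>\<close>. No set is \<open>\<Sigma>\<^sup>0\<^sub>0\<close>, which is why \<open>1 \<le> \<beta>\<close> and \<open>\<gamma> > 1\<close>
  need not be required in the second rule.
\<close>

inductive Sigma0 :: "nat rel \<Rightarrow> 'a topology \<Rightarrow> nat option \<Rightarrow> 'a set \<Rightarrow> bool"
  for r X where
  "open": "ord_zero r \<beta> \<Longrightarrow> ord_succ r \<beta> \<gamma> \<Longrightarrow> openin X A \<Longrightarrow> Sigma0 r X \<gamma> A"
| union: "(\<forall>i::nat. B i \<subseteq> topspace X \<and> (\<exists>\<beta>. (\<beta>, \<gamma>) \<in> olt r \<and> Sigma0 r X \<beta> (topspace X - B i))) \<Longrightarrow>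
    Sigma0 r X \<gamma> (\<Union>i. B i)"

definition countable_Sigma0_colouring ::
    "nat rel \<Rightarrow> nat option \<Rightarrow> 'a topology \<Rightarrow> 'a rel \<Rightarrow> 'a set set \<Rightarrow> bool" where
  "countable_Sigma0_colouring r \<gamma> X E P \<longleftrightarrow>
     countable P \<and> partition_on (topspace X) P \<and> (\<forall>A\<in>P. Sigma0 r X \<gamma> A) \<and>
     (\<forall>A\<in>P. \<forall>(u, v)\<in>E. \<not> (u \<in> A \<and> v \<in> A))"

end

theory Submission
  imports Defs "HOL-Library.Sublist"
begin

text \<open>
  The argument is by forcing. Conditions are partial labellings of \<open>T\<^sub>\<alpha>\<close> together with an initial
  segment of \<open>y\<close>, in two kinds: those describing points with \<open>n\<^sup>x = \<omega>\<close>, and those describing points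
  with \<open>n\<^sup>x = n\<close> for a fixed \<open>n\<close>, for which moreover \<open>T\<^sup>x(m) = 1\<close> for all \<open>m \<ge> n\<close>. If a colouring
  exists, some condition of the first kind forces the generic point into a \<open>\<Pi>\<^sup>0\<^sub>\<beta>\<close> subset \<open>B\<close>, with
  \<open>\<beta> < \<alpha>\<close>, of one colour class. After lengthening its segment of \<open>y\<close>, reread it as a condition of
  the second kind, with \<open>n\<close> the length of that segment and \<open>n\<close> so large that no \<open>\<langle>m\<rangle>\<close> with \<open>m \<ge> n\<close>
  has rank below \<open>\<beta>\<close>. The two readings cannot be separated by labels of rank below \<open>\<beta>\<close>, and a
  back-and-forth induction on \<open>\<beta>\<close> shows that the second one forces \<open>B\<close> as well. For points of the
  second kind the bit \<open>y(n)\<close> is free, and changing it gives an edge inside \<open>B\<close>.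
\<close>

section \<open>Forcing by generic sequences of conditions\<close>

text \<open>\<open>pt s\<close> is the point read off a descending sequence, \<open>N p\<close> the
  set of points agreeing with \<open>p\<close>. \<open>basic\<close> collects the requirements that
  make \<open>pt s\<close> a point of the space. \<open>N_base\<close> takes the place of openness
  of the sets \<open>N p\<close>, which is not assumed.\<close>

locale generic_points =
  fixes P :: "'c set" and le :: "'c \<Rightarrow> 'c \<Rightarrow> bool" (infix "\<preceq>" 50)
    and basic :: "'c set set"
    and pt :: "(nat \<Rightarrow> 'c) \<Rightarrow> 'a" and N :: "'c \<Rightarrow> 'a set" and X :: "'a topology"
  assumes le_refl: "p \<preceq> p"
    and le_trans: "p \<preceq> q \<Longrightarrow> q \<preceq> u \<Longrightarrow> p \<preceq> u"
    and countable_basic: "countable basic"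
    and basic_dense: "D \<in> basic \<Longrightarrow> p \<in> P \<Longrightarrow> \<exists>q\<in>P. q \<preceq> p \<and> q \<in> D"
    and pt_in_space: "(\<And>i. s i \<in> P \<and> s (Suc i) \<preceq> s i) \<Longrightarrow>
          (\<And>D. D \<in> basic \<Longrightarrow> \<exists>i. \<exists>d\<in>D. s i \<preceq> d) \<Longrightarrow> pt s \<in> topspace X"
    and pt_in_N: "(\<And>i. s i \<in> P \<and> s (Suc i) \<preceq> s i) \<Longrightarrow>
          (\<And>D. D \<in> basic \<Longrightarrow> \<exists>i. \<exists>d\<in>D. s i \<preceq> d) \<Longrightarrow> pt s \<in> N (s i)"
    and N_antimono: "p \<preceq> q \<Longrightarrow> N p \<subseteq> N q"
    and N_base: "(\<And>i. s i \<in> P \<and> s (Suc i) \<preceq> s i) \<Longrightarrow>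
          (\<And>D. D \<in> basic \<Longrightarrow> \<exists>i. \<exists>d\<in>D. s i \<preceq> d) \<Longrightarrow>
          openin X U \<Longrightarrow> pt s \<in> U \<Longrightarrow> \<exists>i. N (s i) \<inter> topspace X \<subseteq> U"
begin

definition dense_conditions :: "'c set \<Rightarrow> bool" where
  "dense_conditions D \<longleftrightarrow> (\<forall>p\<in>P. \<exists>q\<in>P. q \<preceq> p \<and> q \<in> D)"

definition admissible :: "'c set set \<Rightarrow> bool" where
  "admissible \<D> \<longleftrightarrow> countable \<D> \<and> basic \<subseteq> \<D> \<and> (\<forall>D\<in>\<D>. dense_conditions D)"

text \<open>A dense set counts as met once the sequence is below one of its members, so dense sets
  need not be closed downwards.\<close>

definition generic :: "'c set set \<Rightarrow> (nat \<Rightarrow> 'c) \<Rightarrow> bool" where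
  "generic \<D> s \<longleftrightarrow> (\<forall>i. s i \<in> P \<and> s (Suc i) \<preceq> s i) \<and> (\<forall>D\<in>\<D>. \<exists>i. \<exists>d\<in>D. s i \<preceq> d)"

text \<open>Forcing is semantic: all sufficiently generic points below \<open>p\<close> lie in
  \<open>A\<close>. It is preserved by countable intersections because countably many countable
  families have a countable union.\<close>

definition forces :: "'c \<Rightarrow> 'a set \<Rightarrow> bool" where
  "forces p A \<longleftrightarrow> (\<exists>\<D>. admissible \<D> \<and> (\<forall>s i. generic \<D> s \<longrightarrow> s i \<preceq> p \<longrightarrow> pt s \<in> A))"

lemma admissible_basic: "admissible basic"
  using countable_basic basic_dense by (auto simp: admissible_def dense_conditions_def)

lemma admissible_Union:
  "countable I \<Longrightarrow> I \<noteq> {} \<Longrightarrow> (\<And>i. i \<in> I \<Longrightarrow> admissible (\<D> i)) \<Longrightarrow> admissible (\<Union>i\<in>I. \<D> i)"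
  unfolding admissible_def by (intro conjI countable_UN) blast+

lemma generic_mono: "generic \<D> s \<Longrightarrow> \<E> \<subseteq> \<D> \<Longrightarrow> generic \<E> s"
  unfolding generic_def by blast

lemma generic_antimono:
  assumes "generic \<D> s" "i \<le> j"
  shows "s j \<preceq> s i"
  using assms(2) by (induction rule: dec_induct)
    (use assms(1) in \<open>auto simp: generic_def intro: le_refl le_trans\<close>)

lemma generic_common:
  assumes "generic \<D> s" "s i \<preceq> p" "s j \<preceq> q"
  obtains k where "s k \<preceq> p" "s k \<preceq> q" "s k \<in> P"
proof
  show "s (max i j) \<preceq> p" "s (max i j) \<preceq> q"
    using generic_antimono[OF assms(1)] assms(2,3) le_trans max.cobounded1 max.cobounded2 by metis+
  show "s (max i j) \<in> P" using assms(1) by (simp add: generic_def)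
qed

lemma generic_exists:
  assumes "admissible \<D>" "p \<in> P"
  obtains s where "generic \<D> s" "s 0 = p"
proof -
  \<comment> \<open>\<open>P\<close> is itself dense; inserting it makes the family nonempty, as its
    enumeration requires.\<close>
  define D where "D = from_nat_into (insert P \<D>)"
  have ran: "range D = insert P \<D>"
    unfolding D_def using assms(1) by (intro range_from_nat_into) (auto simp: admissible_def)
  have dn: "dense_conditions (D i)" for i
  proof -
    have "D i \<in> insert P \<D>" using ran by blast
    then show ?thesis using assms(1) le_refl by (auto simp: admissible_def dense_conditions_def)
  qed
  have "\<exists>s. \<forall>i. (s i \<in> P \<and> (i = 0 \<longrightarrow> s i = p)) \<and> (s (Suc i) \<preceq> s i \<and> s (Suc i) \<in> D i)"
    by (rule dependent_nat_choice) (use assms(2) dn in \<open>auto simp: dense_conditions_def\<close>)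
  then obtain s where s: "\<And>i. s i \<in> P" "s 0 = p" "\<And>i. s (Suc i) \<preceq> s i" "\<And>i. s (Suc i) \<in> D i"
    by blast
  have "generic \<D> s"
    unfolding generic_def
  proof (intro conjI allI ballI)
    fix E assume "E \<in> \<D>"
    then obtain i where "E = D i" using ran by (metis insertI2 rangeE)
    then show "\<exists>i. \<exists>d\<in>E. s i \<preceq> d" using s(4) le_refl by blast
  qed (use s in auto)
  then show ?thesis using s(2) that by blast
qed

lemma generic_pt:
  assumes "generic \<D> s" "admissible \<D>"
  shows "pt s \<in> topspace X" "pt s \<in> N (s i)"
    "openin X U \<Longrightarrow> pt s \<in> U \<Longrightarrow> \<exists>i. N (s i) \<inter> topspace X \<subseteq> U"
proof -
  have s: "\<And>i. s i \<in> P \<and> s (Suc i) \<preceq> s i" "\<And>D. D \<in> basic \<Longrightarrow> \<exists>i. \<exists>d\<in>D. s i \<preceq> d"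
    using assms unfolding generic_def admissible_def by blast+
  show "pt s \<in> topspace X" by (rule pt_in_space[OF s])
  show "pt s \<in> N (s i)" by (rule pt_in_N[OF s])
  show "\<exists>i. N (s i) \<inter> topspace X \<subseteq> U" if "openin X U" "pt s \<in> U"
    by (rule N_base[OF s that])
qed

lemma forces_antimono: "forces p A \<Longrightarrow> q \<preceq> p \<Longrightarrow> forces q A"
  unfolding forces_def by (meson le_trans)

lemma forces_mono: "forces p A \<Longrightarrow> A \<inter> topspace X \<subseteq> A' \<Longrightarrow> forces p A'"
  unfolding forces_def using generic_pt(1) by blast

lemma forces_nonempty:
  assumes "forces p A" "p \<in> P"
  shows "A \<noteq> {}"
proof -
  obtain \<D> where \<D>: "admissible \<D>" "\<And>s i. generic \<D> s \<Longrightarrow> s i \<preceq> p \<Longrightarrow> pt s \<in> A"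
    using assms(1) by (auto simp: forces_def)
  obtain s where "generic \<D> s" "s 0 = p" using generic_exists[OF \<D>(1) assms(2)] .
  then show ?thesis using \<D>(2)[of s 0] le_refl by auto
qed

lemma forces_topspace: "forces p (topspace X)"
  unfolding forces_def using admissible_basic generic_pt(1) by blast

lemma forces_INT:
  assumes "countable I" "\<And>i. i \<in> I \<Longrightarrow> forces p (A i)"
  shows "forces p (topspace X \<inter> (\<Inter>i\<in>I. A i))"
proof (cases "I = {}")
  case True
  then show ?thesis by (simp add: forces_topspace)
next
  case False
  obtain \<D> where \<D>: "\<And>i. i \<in> I \<Longrightarrow> admissible (\<D> i)"
    "\<And>i s j. i \<in> I \<Longrightarrow> generic (\<D> i) s \<Longrightarrow> s j \<preceq> p \<Longrightarrow> pt s \<in> A i"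
    using assms(2) unfolding forces_def by metis
  have adm: "admissible (\<Union>i\<in>I. \<D> i)"
    using admissible_Union[OF assms(1) False] \<D>(1) by blast
  have "pt s \<in> topspace X \<inter> (\<Inter>i\<in>I. A i)" if "generic (\<Union>i\<in>I. \<D> i) s" "s j \<preceq> p" for s j
    using that \<D>(2) generic_mono[OF that(1)] generic_pt(1)[OF that(1) adm] by (meson INT_I IntI UN_upper)
  then show ?thesis unfolding forces_def using adm by blast
qed

lemma forces_Int: "forces p A \<Longrightarrow> forces p B \<Longrightarrow> forces p (A \<inter> B)"
  using forces_mono[OF forces_INT[of "{A, B}" p id], of "A \<inter> B"] by auto

lemma not_forces_both: "p \<in> P \<Longrightarrow> forces p A \<Longrightarrow> forces p (topspace X - A) \<Longrightarrow> False"
  using forces_nonempty[OF forces_Int] by blast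

text \<open>
  The conditions forcing \<open>A\<close> are thinned out to an antichain: with respect to a well-order of all
  conditions, a generic sequence singles out the least such condition that it is compatible
  with, and only the dense sets belonging to this one have to be met.
\<close>

lemma forces_if_dense:
  assumes dn: "\<And>q. q \<in> P \<Longrightarrow> q \<preceq> p \<Longrightarrow> \<exists>u\<in>P. u \<preceq> q \<and> forces u A"
  shows "forces p A"
proof -
  define E where "E = {u \<in> P. forces u A}"
  have "\<forall>u\<in>E. \<exists>\<D>. admissible \<D> \<and> (\<forall>s i. generic \<D> s \<longrightarrow> s i \<preceq> u \<longrightarrow> pt s \<in> A)"
    by (simp add: E_def forces_def)
  then obtain \<D> where \<D>: "\<And>u. u \<in> E \<Longrightarrow> admissible (\<D> u)"
    "\<And>u s i. u \<in> E \<Longrightarrow> generic (\<D> u) s \<Longrightarrow> s i \<preceq> u \<Longrightarrow> pt s \<in> A"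
    by metis
  define D where "D u = from_nat_into (insert P (\<D> u))" for u
  have ran: "range (D u) = insert P (\<D> u)" if "u \<in> E" for u
    unfolding D_def using \<D>(1)[OF that] by (intro range_from_nat_into) (auto simp: admissible_def)
  have D_dense: "dense_conditions (D u i)" if "u \<in> E" for u i
  proof -
    have "D u i \<in> insert P (\<D> u)" using ran[OF that] by blast
    then show ?thesis using \<D>(1)[OF that] le_refl by (auto simp: admissible_def dense_conditions_def)
  qed
  obtain w :: "'c rel" where w: "well_order_on UNIV w" using well_order_on by blast
  have wf_w: "wf (w - Id)" using w by (simp add: well_order_on_def)
  have total_w: "(a, b) \<in> w - Id \<or> (b, a) \<in> w - Id" if "a \<noteq> b" for a b
    using w that by (auto simp: well_order_on_def linear_order_on_def total_on_def)
  define compat where "compat q u \<longleftrightarrow> (\<exists>t\<in>P. t \<preceq> q \<and> t \<preceq> u)" for q u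
  \<comment> \<open>For \<open>q \<in> P\<close>, \<open>u\<close> is the least element of
    \<open>E\<close> compatible with \<open>q\<close>. This persists below \<open>q\<close>, since
    compatibility passes upwards.\<close>
  define H where "H u q \<longleftrightarrow> u \<in> E \<and> q \<preceq> u \<and> (\<forall>v\<in>E. (v, u) \<in> w - Id \<longrightarrow> \<not> compat q v)" for u q
  define G where
    "G j = {q \<in> P. \<not> compat q p \<or> (\<exists>u. H u q \<and> q \<in> D u j)}" for j :: nat
  have G_dense: "dense_conditions (G j)" for j
    unfolding dense_conditions_def
  proof
    fix q assume q: "q \<in> P"
    show "\<exists>t\<in>P. t \<preceq> q \<and> t \<in> G j"
    proof (cases "compat q p")
      case False
      then show ?thesis using q le_refl by (auto simp: G_def)
    next
      case True
      then obtain t where t: "t \<in> P" "t \<preceq> q" "t \<preceq> p" by (auto simp: compat_def)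
      obtain e where "e \<in> E" "e \<preceq> t" using dn[OF t(1,3)] by (auto simp: E_def)
      then have "e \<in> {u \<in> E. compat t u}" using le_refl by (auto simp: compat_def E_def)
      then obtain u where u: "u \<in> E" "compat t u"
        and least: "\<And>v. (v, u) \<in> w - Id \<Longrightarrow> v \<in> E \<Longrightarrow> \<not> compat t v"
        using wfE_min[OF wf_w] by (metis (no_types, lifting) mem_Collect_eq)
      obtain t' where t': "t' \<in> P" "t' \<preceq> t" "t' \<preceq> u" using u(2) by (auto simp: compat_def)
      obtain d where d: "d \<in> P" "d \<preceq> t'" "d \<in> D u j"
        using D_dense[OF u(1)] t'(1) by (auto simp: dense_conditions_def)
      have "H u d"
        unfolding H_def compat_def using u(1) d t' least le_trans unfolding compat_def by meson
      then show ?thesis using d t t' le_trans unfolding G_def by blast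
    qed
  qed
  have adm: "admissible (range G \<union> basic)"
    using G_dense admissible_basic by (auto simp: admissible_def)
  have "pt s \<in> A" if s: "generic (range G \<union> basic) s" "s i \<preceq> p" for s i
  proof -
    have "\<exists>q u k. H u q \<and> q \<in> D u j \<and> s k \<preceq> q" for j
    proof -
      obtain k q where kq: "q \<in> G j" "s k \<preceq> q" using s(1) unfolding generic_def by blast
      have "compat q p"
        using generic_common[OF s(1) kq(2) s(2)] unfolding compat_def by metis
      then show ?thesis using kq by (auto simp: G_def)
    qed
    then obtain q u k where H: "\<And>j. H (u j) (q j)" "\<And>j. q j \<in> D (u j) j" "\<And>j. s (k j) \<preceq> q j"
      by metis
    \<comment> \<open>Some \<open>s k\<close> lies below both \<open>q j'\<close> and
      \<open>u j\<close>, so a smaller \<open>u j\<close> would contradict minimality of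
      \<open>u j'\<close>. Hence all \<open>u j\<close> coincide.\<close>
    have least: "(u j, u j') \<notin> w - Id" for j j'
    proof
      assume "(u j, u j') \<in> w - Id"
      then have "\<not> compat (q j') (u j)" using H(1) unfolding H_def by blast
      moreover have "s (k j) \<preceq> u j" using H le_trans unfolding H_def by blast
      ultimately show False
        using generic_common[OF s(1) H(3)] unfolding compat_def by metis
    qed
    have u_eq: "u j = u 0" for j using total_w least by metis
    have u0: "u 0 \<in> E" "s (k 0) \<preceq> u 0" using H le_trans unfolding H_def by blast+
    have "generic (\<D> (u 0)) s"
      unfolding generic_def
    proof (intro conjI allI ballI)
      fix F assume "F \<in> \<D> (u 0)"
      then obtain j where "F = D (u 0) j" using ran[OF u0(1)] by (metis insertI2 rangeE)
      then show "\<exists>i. \<exists>d\<in>F. s i \<preceq> d" using H(2,3) u_eq by metis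
    qed (use s(1) in \<open>auto simp: generic_def\<close>)
    then show ?thesis using \<D>(2) u0 by blast
  qed
  then show ?thesis unfolding forces_def using adm by blast
qed

section \<open>Deciding Borel sets\<close>

definition decided :: "'a set \<Rightarrow> bool" where
  "decided A \<longleftrightarrow> (\<forall>p\<in>P. \<exists>q\<in>P. q \<preceq> p \<and> (forces q A \<or> forces q (topspace X - A)))"

lemma forces_compl_if:
  assumes "decided A" "\<And>q. q \<in> P \<Longrightarrow> q \<preceq> p \<Longrightarrow> \<not> forces q A"
  shows "forces p (topspace X - A)"
proof (rule forces_if_dense)
  fix q assume q: "q \<in> P" "q \<preceq> p"
  then obtain u where "u \<in> P" "u \<preceq> q" "forces u A \<or> forces u (topspace X - A)"
    using assms(1) unfolding decided_def by blast
  then show "\<exists>u\<in>P. u \<preceq> q \<and> forces u (topspace X - A)" using assms(2) q le_trans by blast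
qed

text \<open>If no extension forced a member, \<open>p\<close> would force every complement, hence
  all of the countably many at once, against forcing the union.\<close>

lemma forces_UnionD:
  assumes "countable \<A>" "\<And>A. A \<in> \<A> \<Longrightarrow> decided A" "p \<in> P" "forces p (\<Union>\<A>)"
  shows "\<exists>q\<in>P. q \<preceq> p \<and> (\<exists>A\<in>\<A>. forces q A)"
proof (rule ccontr)
  assume neg: "\<not> ?thesis"
  have "forces p (topspace X - A)" if "A \<in> \<A>" for A
    using forces_compl_if[OF assms(2)[OF that], of p] neg \<open>A \<in> \<A>\<close> that by blast
  then have "forces p (topspace X \<inter> (\<Inter>A\<in>\<A>. topspace X - A))"
    by (rule forces_INT[OF assms(1)])
  then have "forces p (\<Union>\<A> \<inter> (topspace X \<inter> (\<Inter>A\<in>\<A>. topspace X - A)))"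
    by (rule forces_Int[OF assms(4)])
  then show False using forces_nonempty assms(3) by blast
qed

lemma forces_if_N: "p \<in> P \<Longrightarrow> N p \<inter> topspace X \<subseteq> A \<Longrightarrow> forces p A"
  unfolding forces_def
  using admissible_basic generic_pt N_antimono by (metis IntI subset_iff)

lemma forces_openE:
  assumes "openin X U" "p \<in> P" "forces p U"
  obtains q where "q \<in> P" "q \<preceq> p" "N q \<inter> topspace X \<subseteq> U"
proof -
  obtain \<D> where \<D>: "admissible \<D>" "\<And>s i. generic \<D> s \<Longrightarrow> s i \<preceq> p \<Longrightarrow> pt s \<in> U"
    using assms(3) by (auto simp: forces_def)
  obtain s where s: "generic \<D> s" "s 0 = p" using generic_exists[OF \<D>(1) assms(2)] .
  then have "pt s \<in> U" using \<D>(2)[of s 0] le_refl by auto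
  then obtain i where "N (s i) \<inter> topspace X \<subseteq> U" using generic_pt(3)[OF s(1) \<D>(1) assms(1)] by blast
  moreover have "s i \<preceq> p" using generic_antimono[OF s(1), of 0 i] s(2) by simp
  ultimately show ?thesis using that s(1) by (auto simp: generic_def)
qed

text \<open>If no \<open>q\<close> below \<open>p\<close> has \<open>N q\<close> inside
  \<open>U\<close>, then no generic point below \<open>p\<close> lies in \<open>U\<close>: by
  \<open>N_base\<close> a late stage of its sequence would be such a \<open>q\<close>.\<close>

lemma decided_open:
  assumes "openin X U"
  shows "decided U"
  unfolding decided_def
proof
  fix p assume p: "p \<in> P"
  show "\<exists>q\<in>P. q \<preceq> p \<and> (forces q U \<or> forces q (topspace X - U))"
  proof (cases "\<exists>q\<in>P. q \<preceq> p \<and> N q \<inter> topspace X \<subseteq> U")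
    case True
    then show ?thesis using forces_if_N by blast
  next
    case False
    have "pt s \<in> topspace X - U" if s: "generic basic s" "s i \<preceq> p" for s i
    proof (rule ccontr)
      assume "pt s \<notin> topspace X - U"
      then obtain j where j: "N (s j) \<inter> topspace X \<subseteq> U"
        using generic_pt[OF s(1) admissible_basic] assms by blast
      obtain k where "s k \<preceq> s j" "s k \<preceq> p" "s k \<in> P"
        using generic_common[OF s(1) le_refl s(2)] .
      then show False using j N_antimono False by blast
    qed
    then have "forces p (topspace X - U)" unfolding forces_def using admissible_basic by blast
    then show ?thesis using p le_refl by blast
  qed
qed

lemma decided_compl: "A \<subseteq> topspace X \<Longrightarrow> decided (topspace X - A) \<Longrightarrow> decided A"
  unfolding decided_def by (metis double_diff order_refl)

text \<open>Either some extension forces one piece of the union, or \<open>p\<close> forces the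
  complements of all pieces simultaneously.\<close>

lemma decided_Sigma0: "Sigma0 r X \<gamma> A \<Longrightarrow> decided A"
proof (induction rule: Sigma0.induct)
  case ("open" \<beta> \<gamma> A)
  then show ?case by (simp add: decided_open)
next
  case (union B \<gamma>)
  then have dec: "decided (B i)" for i by (meson decided_compl)
  show ?case unfolding decided_def
  proof
    fix p assume p: "p \<in> P"
    show "\<exists>q\<in>P. q \<preceq> p \<and> (forces q (\<Union>i. B i) \<or> forces q (topspace X - (\<Union>i. B i)))"
    proof (cases "\<exists>q\<in>P. q \<preceq> p \<and> (\<exists>i. forces q (B i))")
      case True
      then show ?thesis by (meson UN_upper UNIV_I forces_mono inf.coboundedI1)
    next
      case False
      then have "forces p (topspace X - B i)" for i
        using forces_compl_if[OF dec] by blast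
      then have "forces p (topspace X \<inter> (\<Inter>i. topspace X - B i))"
        by (intro forces_INT) auto
      then have "forces p (topspace X - (\<Union>i. B i))" by (rule forces_mono) auto
      then show ?thesis using p le_refl by blast
    qed
  qed
qed

text \<open>Back and forth: if \<open>q\<close> did not force the complement, some \<open>u\<close>
  below \<open>q\<close> would force a piece \<open>B i\<close>, whose complement is of a lower
  class \<beta>. By \<open>step\<close> some \<open>p'\<close> below \<open>p\<close> satisfies
  \<open>R \<beta> u p'\<close>, so by induction \<open>p'\<close> forces \<open>B i\<close> too,
  which contradicts the assumption on \<open>p\<close>. The two sides change roles at each
  step.\<close>

lemma forces_transfer:
  assumes zero: "\<And>\<gamma> p q. ord_zero r \<gamma> \<Longrightarrow> R \<gamma> p q \<Longrightarrow> N q \<subseteq> N p"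
    and step: "\<And>\<gamma> \<gamma>' p q q'. R \<gamma> p q \<Longrightarrow> (\<gamma>', \<gamma>) \<in> olt r \<Longrightarrow> q' \<in> P \<Longrightarrow> q' \<preceq> q \<Longrightarrow>
      \<exists>p'\<in>P. p' \<preceq> p \<and> R \<gamma>' q' p'"
  shows "Sigma0 r X \<gamma> A \<Longrightarrow> R \<gamma> p q \<Longrightarrow> p \<in> P \<Longrightarrow> q \<in> P \<Longrightarrow> forces p (topspace X - A) \<Longrightarrow>
    forces q (topspace X - A)"
proof (induction arbitrary: p q rule: Sigma0.induct)
  case ("open" \<beta> \<gamma> A)
  show ?case
  proof (rule forces_compl_if[OF decided_open[OF open.hyps(3)]])
    fix q' assume q': "q' \<in> P" "q' \<preceq> q"
    show "\<not> forces q' A"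
    proof
      assume "forces q' A"
      then obtain u where u: "u \<in> P" "u \<preceq> q'" "N u \<inter> topspace X \<subseteq> A"
        using forces_openE[OF open.hyps(3) q'(1)] by blast
      \<comment> \<open>Here \<beta> is 0, so after one step the relation compares neighbourhoods
        directly.\<close>
      have "(\<beta>, \<gamma>) \<in> olt r" using open.hyps by (simp add: ord_succ_def)
      then obtain p' where p': "p' \<in> P" "p' \<preceq> p" "R \<beta> u p'"
        using step[OF open.prems(1)] u q' le_trans by meson
      then have "N p' \<inter> topspace X \<subseteq> A" using zero[OF open.hyps(1)] u(3) by blast
      then show False
        using not_forces_both forces_if_N p' forces_antimono open.prems(4) by blast
    qed
  qed
next
  case (union B \<gamma>)
  have dec: "decided (B i)" for i using union decided_Sigma0 by (meson decided_compl)
  have "Sigma0 r X \<gamma> (\<Union>i. B i)" using union by (intro Sigma0.union) blast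
  then show ?case
  proof (rule forces_compl_if[OF decided_Sigma0])
    fix q' assume q': "q' \<in> P" "q' \<preceq> q"
    show "\<not> forces q' (\<Union>i. B i)"
    proof
      assume "forces q' (\<Union>i. B i)"
      then obtain u i where u: "u \<in> P" "u \<preceq> q'" "forces u (B i)"
        using forces_UnionD[of "range B" q'] dec q'(1) by auto
      obtain \<beta> where \<beta>: "(\<beta>, \<gamma>) \<in> olt r" "B i \<subseteq> topspace X"
        and IH: "\<And>p q. R \<beta> p q \<Longrightarrow> p \<in> P \<Longrightarrow> q \<in> P \<Longrightarrow> forces p (topspace X - (topspace X - B i)) \<Longrightarrow>
          forces q (topspace X - (topspace X - B i))"
        using union.IH by blast
      obtain p' where p': "p' \<in> P" "p' \<preceq> p" "R \<beta> u p'"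
        using step[OF union.prems(1) \<beta>(1)] u q' le_trans by meson
      have "forces p' (B i)" using IH[OF p'(3) u(1) p'(1)] u(3) \<beta>(2) by (simp add: double_diff)
      then have "forces p' (\<Union>i. B i)" by (rule forces_mono) auto
      then show False using not_forces_both p' forces_antimono union.prems(4) by blast
    qed
  qed
qed

end

section \<open>Ranks and codes\<close>

text \<open>\<open>two_elements\<close> ensures that neither the root nor its children are
  leaves.\<close>

locale ordinal_tree =
  fixes r :: "nat rel" and fs :: "nat option \<Rightarrow> nat \<Rightarrow> nat"
  assumes well_order: "Well_order r"
    and two_elements: "\<exists>a\<in>Field r. \<exists>b\<in>Field r. a \<noteq> b"
    and fund: "fundamental_sequences r fs"
begin

abbreviation olt_less (infix "\<lhd>" 50) where "\<beta> \<lhd> \<gamma> \<equiv> (\<beta>, \<gamma>) \<in> olt r"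

lemma r_props: "trans r" "antisym r" "total_on (Field r) r"
  using well_order
  by (auto simp: well_order_on_def linear_order_on_def partial_order_on_def preorder_on_def)

lemma less_trans [trans]: "\<beta> \<lhd> \<gamma> \<Longrightarrow> \<gamma> \<lhd> \<delta> \<Longrightarrow> \<beta> \<lhd> \<delta>"
  using r_props(1,2) unfolding olt_def
  by (auto dest: transD antisymD intro: FieldI1)

lemma less_irrefl: "\<not> \<beta> \<lhd> \<beta>"
  by (auto simp: olt_def)

lemma less_ords: "\<beta> \<lhd> \<gamma> \<Longrightarrow> \<beta> \<in> ords r" "\<beta> \<lhd> \<gamma> \<Longrightarrow> \<gamma> \<in> ords r"
  by (auto simp: olt_def ords_def intro: FieldI1 FieldI2)

lemma less_total: "\<beta> \<in> ords r \<Longrightarrow> \<gamma> \<in> ords r \<Longrightarrow> \<beta> \<lhd> \<gamma> \<or> \<beta> = \<gamma> \<or> \<gamma> \<lhd> \<beta>"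
  using r_props(3) unfolding olt_def ords_def total_on_def by (cases \<beta>; cases \<gamma>) auto

definition rk :: "nat list \<Rightarrow> nat option" where
  "rk \<sigma> = (THE \<rho>. tree_rank r fs \<sigma> \<rho>)"

lemma rk_eq: "tree_rank r fs \<sigma> \<rho> \<Longrightarrow> rk \<sigma> = \<rho>"
  unfolding rk_def using tree_rank_unique[OF well_order] by blast

lemma tree_rank_iff: "tree_rank r fs \<sigma> \<rho> \<longleftrightarrow> \<sigma> \<in> tree r fs \<and> rk \<sigma> = \<rho>"
  using rk_eq by (auto simp: tree_def)

lemma leaves_iff: "\<sigma> \<in> leaves r fs \<longleftrightarrow> \<sigma> \<in> tree r fs \<and> ord_zero r (rk \<sigma>)"
  by (auto simp: leaves_def tree_rank_iff)

lemma root_tree: "[] \<in> tree r fs" "rk [] = None"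
  using tree_rank.root[of r fs] by (simp_all add: tree_rank_iff)

lemma fund_less:
  assumes "ord_limit r \<delta>"
  shows "Some (fs \<delta> k) \<lhd> \<delta>" "i < j \<Longrightarrow> Some (fs \<delta> i) \<lhd> Some (fs \<delta> j)"
    "\<beta> \<lhd> \<delta> \<Longrightarrow> \<exists>k. \<beta> \<lhd> Some (fs \<delta> k)" "\<not> ord_zero r (Some (fs \<delta> k))"
proof -
  have fs: "\<And>k. Some (fs \<delta> k) \<lhd> \<delta>" "\<And>k. Some (fs \<delta> k) \<lhd> Some (fs \<delta> (Suc k))"
    "\<And>\<beta>. \<beta> \<lhd> \<delta> \<Longrightarrow> \<exists>k. \<beta> \<lhd> Some (fs \<delta> k)" "\<exists>\<gamma>. ord_succ r \<gamma> (Some (fs \<delta> k))"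
    using fund assms unfolding fundamental_sequences_def by blast+
  show "Some (fs \<delta> k) \<lhd> \<delta>" "\<beta> \<lhd> \<delta> \<Longrightarrow> \<exists>k. \<beta> \<lhd> Some (fs \<delta> k)" using fs by blast+
  show "\<not> ord_zero r (Some (fs \<delta> k))" using fs(4) by (auto simp: ord_zero_def ord_succ_def)
  show "Some (fs \<delta> i) \<lhd> Some (fs \<delta> j)" if "i < j"
    using that by (induction rule: strict_inc_induct) (auto intro: fs(2) less_trans)
qed

lemma parent_tree:
  assumes "\<sigma> @ [k] \<in> tree r fs"
  shows "\<sigma> \<in> tree r fs" "rk (\<sigma> @ [k]) \<lhd> rk \<sigma>" "\<sigma> \<notin> leaves r fs"
proof -
  have "tree_rank r fs (\<sigma> @ [k]) (rk (\<sigma> @ [k]))" using assms by (simp add: tree_rank_iff)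
  then show "\<sigma> \<in> tree r fs" "rk (\<sigma> @ [k]) \<lhd> rk \<sigma>"
    by (cases; use fund_less in \<open>auto simp: tree_rank_iff ord_succ_def\<close>)+
  then show "\<sigma> \<notin> leaves r fs" by (auto simp: leaves_iff ord_zero_def)
qed

lemma rk_ords:
  assumes "\<sigma> \<in> tree r fs"
  shows "rk \<sigma> \<in> ords r"
proof (cases \<sigma> rule: rev_cases)
  case Nil
  then show ?thesis by (simp add: root_tree ords_def)
next
  case (snoc \<tau> k)
  then show ?thesis using assms parent_tree(2) less_ords(1) by blast
qed

lemma child_cases:
  assumes "\<sigma> \<in> tree r fs" "\<sigma> \<notin> leaves r fs"
  obtains (limit) "ord_limit r (rk \<sigma>)"
      "\<And>k. \<sigma> @ [k] \<in> tree r fs \<and> rk (\<sigma> @ [k]) = Some (fs (rk \<sigma>) k)"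
    | (succ) \<beta> where "ord_succ r \<beta> (rk \<sigma>)" "\<And>k. \<sigma> @ [k] \<in> tree r fs \<and> rk (\<sigma> @ [k]) = \<beta>"
proof -
  have "tree_rank r fs \<sigma> (rk \<sigma>)" using assms by (simp add: tree_rank_iff)
  note children = tree_rank.limit[OF this] tree_rank.succ[OF this]
  have "\<not> ord_zero r (rk \<sigma>)" using assms by (simp add: leaves_iff)
  then have "ord_limit r (rk \<sigma>) \<or> (\<exists>\<beta>. ord_succ r \<beta> (rk \<sigma>))"
    using rk_ords[OF assms(1)] unfolding ord_limit_def by blast
  then show ?thesis using children that unfolding tree_rank_iff by blast
qed

lemma child_tree: "\<sigma> \<in> tree r fs \<Longrightarrow> \<sigma> \<notin> leaves r fs \<Longrightarrow> \<sigma> @ [k] \<in> tree r fs"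
  by (metis child_cases)

text \<open>At a limit node the ranks of the children increase cofinally, so only finitely many are
  below \<gamma>; at a successor node all children have the predecessor as rank, and none is below
  \<gamma>.\<close>

lemma finite_children_below:
  assumes "\<sigma> \<in> tree r fs" "\<gamma> \<lhd> rk \<sigma>"
  shows "finite {k. rk (\<sigma> @ [k]) \<lhd> \<gamma>}"
proof -
  have "\<sigma> \<notin> leaves r fs" using assms(2) by (auto simp: leaves_iff ord_zero_def)
  with assms(1) show ?thesis
  proof (cases rule: child_cases)
    case limit
    obtain i where i: "\<gamma> \<lhd> Some (fs (rk \<sigma>) i)" using fund_less(3)[OF limit(1) assms(2)] by blast
    have "k < i" if "rk (\<sigma> @ [k]) \<lhd> \<gamma>" for k
    proof (rule ccontr)
      assume "\<not> k < i"
      then have "i = k \<or> Some (fs (rk \<sigma>) i) \<lhd> Some (fs (rk \<sigma>) k)"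
        using fund_less(2)[OF limit(1), of i k] by (cases "i = k") auto
      moreover have "Some (fs (rk \<sigma>) k) \<lhd> \<gamma>" using that limit(2)[of k] by simp
      ultimately have "Some (fs (rk \<sigma>) i) \<lhd> \<gamma>" using less_trans by blast
      then show False using i less_trans less_irrefl by blast
    qed
    then show ?thesis by (meson bounded_nat_set_is_finite mem_Collect_eq)
  next
    case (succ \<beta>)
    then have "{k. rk (\<sigma> @ [k]) \<lhd> \<gamma>} = {}" using assms(2) by (auto simp: ord_succ_def)
    then show ?thesis by simp
  qed
qed

lemma root_not_leaf: "[] \<notin> leaves r fs"
  using two_elements by (auto simp: leaves_iff root_tree ord_zero_def olt_def)

lemma level1:
  shows "[m] \<in> tree r fs" "[m] \<notin> leaves r fs"
proof -
  show tr: "[m] \<in> tree r fs" using child_tree[OF root_tree(1) root_not_leaf, of m] by simp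
  show "[m] \<notin> leaves r fs"
  proof (cases rule: child_cases[OF root_tree(1) root_not_leaf])
    case 1
    then show ?thesis using fund_less(4)[of None m] by (simp add: leaves_iff root_tree)
  next
    case (2 \<beta>)
    then have succ: "ord_succ r \<beta> None" and rk: "rk [m] = \<beta>" by (auto simp: root_tree)
    obtain a b where ab: "a \<in> Field r" "b \<in> Field r" "a \<noteq> b" using two_elements by blast
    \<comment> \<open>As \<beta> is the predecessor of the top, any other element \<open>c\<close>
      lies below \<beta>, so \<beta> is not 0.\<close>
    have "\<exists>c. Some c \<noteq> \<beta> \<and> c \<in> Field r" using ab by (metis option.inject)
    then obtain c where c: "Some c \<noteq> \<beta>" "c \<in> Field r" by blast
    then have "Some c \<lhd> None" by (simp add: olt_def)
    then have "Some c \<lhd> \<beta>"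
      using succ c less_total[of "Some c" \<beta>] less_ords unfolding ord_succ_def by metis
    then show ?thesis by (auto simp: leaves_iff rk ord_zero_def)
  qed
qed

lemma level2: "[m, k] \<in> tree r fs"
  using child_tree[OF level1, of m k] by simp

text \<open>Provides the bound beyond which labels of rank below \<beta> cannot tell type
  \<open>Some n\<close> from type \<open>None\<close>.\<close>

lemma level1_rank_unbounded:
  assumes "\<beta> \<lhd> None"
  obtains n where "\<And>m. n \<le> m \<Longrightarrow> \<not> rk [m] \<lhd> \<beta>"
proof (cases rule: child_cases[OF root_tree(1) root_not_leaf])
  case 1
  then have lim: "ord_limit r None" and rk: "\<And>m. rk [m] = Some (fs None m)"
    by (auto simp: root_tree)
  obtain n where n: "\<beta> \<lhd> Some (fs None n)" using fund_less(3)[OF lim assms] by blast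
  show ?thesis
  proof
    fix m assume "n \<le> m"
    then have "\<beta> \<lhd> rk [m]"
      using n less_trans[OF n fund_less(2)[OF lim, of n m]] rk[of m] by (cases "n = m") auto
    then show "\<not> rk [m] \<lhd> \<beta>" using less_trans less_irrefl by blast
  qed
next
  case (2 \<xi>)
  have "\<not> rk [m] \<lhd> \<beta>" for m
  proof -
    have "rk [m] = \<xi>" "ord_succ r \<xi> None" using 2(1) 2(2)[of m] by (simp_all add: root_tree)
    then show ?thesis using assms unfolding ord_succ_def by blast
  qed
  then show ?thesis by (rule that[of 0])
qed

end

section \<open>Codes of finite strings\<close>

lemma codes_iff_nth: "codes M k \<zeta> \<longleftrightarrow> (\<forall>i<length \<zeta>. \<zeta> ! i = M k i)"
  unfolding codes_def restr_def by (subst list_eq_iff_nth_eq) simp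

lemma dense_list_codes:
  assumes "dense_list M"
  shows "\<exists>k. codes M k \<zeta>"
proof -
  define U where "U = Pi\<^sub>E UNIV (\<lambda>i. if i < length \<zeta> then {\<zeta> ! i} else UNIV)"
  have "openin cantor_space U"
    unfolding cantor_space_def U_def by (rule product_topology_basis) (auto intro: finite_subset)
  moreover have "(\<lambda>i. i < length \<zeta> \<and> \<zeta> ! i) \<in> U" by (auto simp: U_def)
  moreover have "(\<lambda>i. i < length \<zeta> \<and> \<zeta> ! i) \<in> cantor_space closure_of (range M)"
    using assms by (simp add: dense_list_def cantor_space_def)
  ultimately obtain k where "M k \<in> U" by (auto simp: in_closure_of)
  then have "codes M k \<zeta>" by (auto simp: U_def codes_iff_nth PiE_iff split: if_splits)
  then show ?thesis ..
qed

lemma codes_appendD: "codes M k (\<zeta> @ \<xi>) \<Longrightarrow> codes M k \<zeta>"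
  unfolding codes_iff_nth
proof (intro allI impI)
  fix i assume *: "\<forall>i<length (\<zeta> @ \<xi>). (\<zeta> @ \<xi>) ! i = M k i" and i: "i < length \<zeta>"
  then have "(\<zeta> @ \<xi>) ! i = M k i" by simp
  then show "\<zeta> ! i = M k i" using i by (simp only: nth_append if_True)
qed

text \<open>The strings obtained from \<zeta> by appending \<open>j\<close> zeros and a one are
  pairwise incompatible, so their codes are distinct; each of them also codes \<zeta>.\<close>

lemma infinite_codes:
  assumes "dense_list M"
  shows "infinite {k. codes M k \<zeta>}"
proof -
  have "\<forall>j. \<exists>k. codes M k (\<zeta> @ replicate j False @ [True])"
    using dense_list_codes[OF assms] by blast
  from choice[OF this] obtain f where f: "\<And>j. codes M (f j) (\<zeta> @ replicate j False @ [True])"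
    by blast
  have val: "M (f j) (length \<zeta> + i) = (i = j)" if "i \<le> j" for i j
  proof -
    let ?\<xi> = "replicate j False @ [True]"
    have "(\<zeta> @ ?\<xi>) ! (length \<zeta> + i) = M (f j) (length \<zeta> + i)"
      by (rule f[unfolded codes_iff_nth, rule_format]) (use that in simp)
    moreover have "(\<zeta> @ ?\<xi>) ! (length \<zeta> + i) = ?\<xi> ! i" by (rule nth_append_length_plus)
    moreover have "?\<xi> ! i = (i = j)" using that by (auto simp: nth_append)
    ultimately show ?thesis by simp
  qed
  have "inj f"
  proof (rule linorder_injI)
    fix i j :: nat assume "i < j"
    then show "f i \<noteq> f j" using val[of i i] val[of i j] by auto
  qed
  then have "infinite (range f)" by (rule range_inj_infinite)
  moreover have "range f \<subseteq> {k. codes M k \<zeta>}" using f codes_appendD by blast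
  ultimately show ?thesis using finite_subset by blast
qed

section \<open>Conditions for points of the space\<close>

text \<open>
  A condition of type \<open>None\<close> describes points with \<open>n\<^sup>x = \<omega>\<close>; a condition of type \<open>Some n\<close> describes
  points such that \<open>T\<^sup>x(m) = 1\<close> exactly for \<open>m \<ge> n\<close>. Labels are only recorded from level two on.
\<close>

datatype cond = Cond (ctype: "nat option") (ones: "nat list set") (zeros: "nat list set")
  (str: "bool list")

text \<open>At tree nodes from level two on, these are the zeros implied by the condition: recorded
  ones, children of a node labelled 1, and nodes below \<open>[m]\<close> with
  \<open>n \<le> m\<close>, where \<open>[m]\<close> is to be labelled 1.\<close>

definition must_zero :: "cond \<Rightarrow> nat list \<Rightarrow> bool" where
  "must_zero c \<tau> \<longleftrightarrow> \<tau> \<in> zeros c \<or> (\<exists>\<sigma> k. \<tau> = \<sigma> @ [k] \<and> \<sigma> \<in> ones c) \<or>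
     (\<exists>n m k. ctype c = Some n \<and> n \<le> m \<and> \<tau> = [m, k])"

definition extends :: "cond \<Rightarrow> cond \<Rightarrow> bool" where
  "extends d c \<longleftrightarrow> ctype d = ctype c \<and> ones c \<subseteq> ones d \<and> zeros c \<subseteq> zeros d \<and> prefix (str c) (str d)"

lemma extends_refl: "extends c c"
  by (simp add: extends_def)

lemma extends_trans: "extends e d \<Longrightarrow> extends d c \<Longrightarrow> extends e c"
  by (auto simp: extends_def intro: prefix_order.trans)

lemma must_zero_mono: "extends d c \<Longrightarrow> must_zero c \<tau> \<Longrightarrow> must_zero d \<tau>"
  unfolding extends_def must_zero_def by auto

text \<open>Infinitely many zeros are allowed, but only finitely many under each parent, so that
  some child always remains free to be labelled 1.\<close>

definition finitely_branching :: "nat list set \<Rightarrow> bool" where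
  "finitely_branching Z \<longleftrightarrow> (\<forall>\<sigma>. finite {k. \<sigma> @ [k] \<in> Z})"

lemma finitely_branchingD: "finitely_branching Z \<Longrightarrow> finite {k. \<sigma> @ [k] \<in> Z}"
  unfolding finitely_branching_def by blast

locale coded_tree = ordinal_tree +
  fixes M :: "nat \<Rightarrow> nat \<Rightarrow> bool"
  assumes dense_M: "dense_list M"
begin

definition least_witness :: "cond \<Rightarrow> nat \<Rightarrow> nat \<Rightarrow> bool" where
  "least_witness c m k \<longleftrightarrow> [m, k] \<in> ones c \<and> (\<forall>k'<k. [m, k'] \<in> zeros c) \<and>
     codes M k (take (Suc m) (str c))"

text \<open>No \<open>[m, k]\<close> is a one before bit \<open>m\<close> is fixed, so the least
  witness can then be chosen to code the known bits. For type \<open>Some n\<close> the string has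
  length at least \<open>n\<close>, so all witnesses are already present.\<close>

definition valid :: "cond \<Rightarrow> bool" where
  "valid c \<longleftrightarrow>
     finite (ones c) \<and> ones c \<subseteq> {\<sigma> \<in> tree r fs. 2 \<le> length \<sigma>} \<and>
     finitely_branching (zeros c) \<and>
     (\<forall>\<tau>\<in>ones c. \<not> must_zero c \<tau>) \<and>
     (\<forall>m k. [m, k] \<in> ones c \<longrightarrow> m < length (str c)) \<and>
     (\<forall>n. ctype c = Some n \<longrightarrow> n \<le> length (str c)) \<and>
     (\<forall>m<length (str c). (\<forall>n. ctype c = Some n \<longrightarrow> m < n) \<longrightarrow> (\<exists>k. least_witness c m k))"

section \<open>Extending valid conditions\<close>

lemma valid_witness:
  assumes "valid c" "m < length (str c)" "\<And>n. ctype c = Some n \<Longrightarrow> m < n"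
  shows "\<exists>k. least_witness c m k"
  using assms unfolding valid_def by blast

lemma least_witness_mono:
  assumes "least_witness c m k" "m < length (str c)"
    "ones c \<subseteq> ones d" "zeros c \<subseteq> zeros d" "prefix (str c) (str d)"
  shows "least_witness d m k"
  using assms by (auto simp: least_witness_def prefix_def)

text \<open>The string already has length at least \<open>n\<close>, and bits from \<open>n\<close>
  on are read by no witness, so either value may be appended.\<close>

lemma extend_Some:
  assumes "valid c" "ctype c = Some n"
  shows "valid (Cond (Some n) (ones c) (zeros c) (str c @ [b]))"
    "extends (Cond (Some n) (ones c) (zeros c) (str c @ [b])) c"
proof -
  let ?d = "Cond (Some n) (ones c) (zeros c) (str c @ [b])"
  show "extends ?d c" using assms by (simp add: extends_def)
  have mz: "must_zero ?d \<tau> = must_zero c \<tau>" for \<tau> using assms(2) by (simp add: must_zero_def)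
  have wit: "\<exists>k. least_witness ?d m k" if mn: "m < n" for m
  proof -
    have m: "m < length (str c)" using mn assms by (auto simp: valid_def)
    then obtain k where "least_witness c m k" using valid_witness[OF assms(1)] mn assms(2) by auto
    then show ?thesis using least_witness_mono[of c m k ?d] m by auto
  qed
  have "\<forall>m k. [m, k] \<in> ones c \<longrightarrow> m < Suc (length (str c))" "n \<le> Suc (length (str c))"
    using assms unfolding valid_def by (blast intro: less_SucI le_SucI)+
  then show "valid ?d" using assms wit mz unfolding valid_def by simp
qed

text \<open>The new bit requires a witness \<open>k\<close> for \<open>N\<close>, the old length.
  Infinitely many \<open>k\<close> code the longer string, and only finitely many are excluded, by
  being recorded zeros or by having a recorded one as child. All smaller candidates become
  zeros.\<close>

lemma extend_None:
  assumes c: "valid c" and ct: "ctype c = None"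
  obtains d where "valid d" "extends d c" "str d = str c @ [b]"
proof -
  define N where "N = length (str c)"
  have fin1: "finite {k. [N, k] \<in> zeros c}"
    using c finitely_branchingD[of "zeros c" "[N]"] unfolding valid_def append_Cons append_Nil by blast
  have "{k. \<exists>j. [N, k, j] \<in> ones c} \<subseteq> (\<lambda>\<tau>. \<tau> ! 1) ` ones c" by force
  then have fin2: "finite {k. \<exists>j. [N, k, j] \<in> ones c}"
    using c finite_surj unfolding valid_def by blast
  have "infinite ({k. codes M k (str c @ [b])} - {k. [N, k] \<in> zeros c} - {k. \<exists>j. [N, k, j] \<in> ones c})"
    using infinite_codes[OF dense_M] fin1 fin2 by (meson Diff_infinite_finite)
  from infinite_imp_nonempty[OF this]
  obtain k where k: "codes M k (str c @ [b])" "[N, k] \<notin> zeros c" "\<And>j. [N, k, j] \<notin> ones c"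
    by blast
  let ?d = "Cond None (insert [N, k] (ones c)) (zeros c \<union> {[N, k'] |k'. k' < k}) (str c @ [b])"
  have N_ones: "[N, j] \<notin> ones c" for j using c by (auto simp: valid_def N_def)
  have ones_length: "2 \<le> length \<tau>" if "\<tau> \<in> ones c" for \<tau> using c that by (auto simp: valid_def)
  have no: "\<not> must_zero ?d \<tau>" if "\<tau> \<in> ones ?d" for \<tau>
  proof (cases "\<tau> = [N, k]")
    case True
    have "\<sigma> \<notin> ones ?d" if "[N, k] = \<sigma> @ [j]" for \<sigma> j
      using that ones_length[of \<sigma>] by (cases \<sigma>) auto
    then show ?thesis using True k by (auto simp: must_zero_def)
  next
    case False
    then have \<tau>: "\<tau> \<in> ones c" using that by simp
    have "\<forall>j. \<tau> \<noteq> [N, k] @ [j]" using \<tau> k(3) by auto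
    moreover have "\<forall>k'. \<tau> \<noteq> [N, k']" using \<tau> N_ones by auto
    moreover have "\<not> must_zero c \<tau>" using c \<tau> by (auto simp: valid_def)
    ultimately show ?thesis by (auto simp: must_zero_def)
  qed
  have wit: "\<exists>j. least_witness ?d m j" if "m < Suc N" for m
  proof (cases "m = N")
    case True
    then have "least_witness ?d m k" using k(1) by (simp add: least_witness_def N_def)
    then show ?thesis ..
  next
    case False
    then have m: "m < length (str c)" using that by (simp add: N_def)
    then obtain j where "least_witness c m j" using valid_witness[OF c] ct by auto
    then show ?thesis using least_witness_mono[of c m j ?d] m by auto
  qed
  have fin: "finitely_branching (zeros ?d)"
    unfolding finitely_branching_def
  proof
    fix \<sigma>
    have "{j. \<sigma> @ [j] \<in> zeros ?d} \<subseteq> {j. \<sigma> @ [j] \<in> zeros c} \<union> {..<k}" by auto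
    moreover have "finite ({j. \<sigma> @ [j] \<in> zeros c} \<union> {..<k})"
      using c finitely_branchingD unfolding valid_def by blast
    ultimately show "finite {j. \<sigma> @ [j] \<in> zeros ?d}" by (rule finite_subset)
  qed
  have "valid ?d"
  proof -
    have "finite (ones ?d)" "ones ?d \<subseteq> {\<sigma> \<in> tree r fs. 2 \<le> length \<sigma>}"
      using c level2 by (auto simp: valid_def)
    moreover have "\<forall>m j. [m, j] \<in> ones ?d \<longrightarrow> m < Suc N"
      using c by (auto simp: valid_def N_def intro: less_SucI)
    ultimately show ?thesis unfolding valid_def using no wit fin by (simp add: N_def)
  qed
  moreover have "extends ?d c" using ct by (auto simp: extends_def)
  ultimately show ?thesis using that[of ?d] by simp
qed

lemma extend_bit:
  assumes "valid c"
  obtains d where "valid d" "extends d c" "str d = str c @ [b]"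
proof (cases "ctype c")
  case None
  then show ?thesis using extend_None[OF assms] that by blast
next
  case (Some n)
  then show ?thesis using that extend_Some[OF assms, of n b] by simp
qed

lemma extend_str:
  assumes "valid c" "prefix (str c) \<zeta>"
  obtains d where "valid d" "extends d c" "str d = \<zeta>"
proof -
  obtain \<xi> where \<xi>: "\<zeta> = str c @ \<xi>" using assms(2) by (auto simp: prefix_def)
  have "\<exists>d. valid d \<and> extends d c \<and> str d = str c @ \<xi>"
  proof (induction \<xi> rule: rev_induct)
    case Nil
    then show ?case using assms(1) extends_refl by auto
  next
    case (snoc b \<xi>)
    then obtain d where d: "valid d" "extends d c" "str d = str c @ \<xi>" by blast
    obtain e where "valid e" "extends e d" "str e = str d @ [b]" using extend_bit[OF d(1)] .
    then show ?case using d extends_trans by (metis append_assoc)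
  qed
  then show ?thesis using \<xi> that by blast
qed

text \<open>A node that is not a one can be recorded as zero, since zeros put no restriction on
  their children.\<close>

lemma extend_decide:
  assumes c: "valid c"
  obtains d where "valid d" "extends d c" "\<tau> \<in> ones d \<or> \<tau> \<in> zeros d"
proof (cases "\<tau> \<in> ones c")
  case True
  then show ?thesis using that[OF c extends_refl] by blast
next
  case False
  let ?d = "Cond (ctype c) (ones c) (insert \<tau> (zeros c)) (str c)"
  have "finitely_branching (zeros ?d)"
    unfolding finitely_branching_def
  proof
    fix \<sigma>
    have "{k. \<sigma> @ [k] \<in> zeros ?d} \<subseteq> insert (last \<tau>) {k. \<sigma> @ [k] \<in> zeros c}" by auto
    moreover have "finite (insert (last \<tau>) {k. \<sigma> @ [k] \<in> zeros c})"
      using c finitely_branchingD unfolding valid_def by blast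
    ultimately show "finite {k. \<sigma> @ [k] \<in> zeros ?d}" by (rule finite_subset)
  qed
  moreover have "\<not> must_zero ?d \<rho>" if "\<rho> \<in> ones c" for \<rho>
    using c that False unfolding valid_def must_zero_def by auto
  moreover have "\<exists>k. least_witness ?d m k"
    if m: "m < length (str c)" "\<forall>n. ctype c = Some n \<longrightarrow> m < n" for m
  proof -
    obtain k where "least_witness c m k" using valid_witness[OF c m(1)] m(2) by blast
    then show ?thesis using least_witness_mono[of c m k ?d] m(1) by auto
  qed
  ultimately have "valid ?d" using c unfolding valid_def by simp
  then show ?thesis using that[of ?d] by (auto simp: extends_def)
qed

text \<open>Finite branching and finiteness of \<open>ones\<close> leave a child that is not a zero
  and has no one below it as child. It has level at least three, so the least witnesses on level two
  are not disturbed.\<close>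

lemma extend_witness:
  assumes c: "valid c" and \<sigma>: "\<sigma> \<in> tree r fs" "\<sigma> \<notin> leaves r fs" "2 \<le> length \<sigma>"
  obtains d where "valid d" "extends d c" "\<sigma> \<in> ones d \<or> (\<exists>k. \<sigma> @ [k] \<in> ones d)"
proof (cases "\<sigma> \<in> ones c")
  case True
  then show ?thesis using that[OF c extends_refl] by blast
next
  case False
  have fin1: "finite {k. \<sigma> @ [k] \<in> zeros c}"
    using c finitely_branchingD unfolding valid_def by blast
  have "{k. \<exists>j. \<sigma> @ [k, j] \<in> ones c} \<subseteq> (\<lambda>\<tau>. \<tau> ! length \<sigma>) ` ones c"
    by (auto intro!: image_eqI[where x = "\<sigma> @ _"])
  then have fin2: "finite {k. \<exists>j. \<sigma> @ [k, j] \<in> ones c}"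
    using c finite_surj unfolding valid_def by blast
  from ex_new_if_finite[OF infinite_UNIV_nat finite_UnI[OF fin1 fin2]]
  obtain k where "k \<notin> {k. \<sigma> @ [k] \<in> zeros c} \<union> {k. \<exists>j. \<sigma> @ [k, j] \<in> ones c}" ..
  then have k: "\<sigma> @ [k] \<notin> zeros c" "\<And>j. \<sigma> @ [k, j] \<notin> ones c" by auto
  let ?d = "Cond (ctype c) (insert (\<sigma> @ [k]) (ones c)) (zeros c) (str c)"
  have len: "\<sigma> @ [k] \<noteq> [m, j]" for m j using \<sigma>(3) by (auto dest: arg_cong[of _ _ length])
  have "\<not> must_zero ?d \<rho>" if "\<rho> \<in> ones ?d" for \<rho>
  proof (cases "\<rho> = \<sigma> @ [k]")
    case True
    then show ?thesis using k False len by (auto simp: must_zero_def)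
  next
    case neq: False
    then have \<rho>: "\<rho> \<in> ones c" "\<not> must_zero c \<rho>" using that c by (auto simp: valid_def)
    moreover have "\<forall>j. \<rho> \<noteq> (\<sigma> @ [k]) @ [j]" using k(2) \<rho>(1) by auto
    ultimately show ?thesis by (auto simp: must_zero_def)
  qed
  moreover have "\<exists>k. least_witness ?d m k"
    if m: "m < length (str c)" "\<forall>n. ctype c = Some n \<longrightarrow> m < n" for m
  proof -
    obtain k where "least_witness c m k" using valid_witness[OF c m(1)] m(2) by blast
    then show ?thesis using least_witness_mono[of c m k ?d] m(1) by auto
  qed
  moreover have "finite (ones ?d)" "ones ?d \<subseteq> {\<sigma> \<in> tree r fs. 2 \<le> length \<sigma>}"
    using c child_tree[OF \<sigma>(1,2)] \<sigma>(3) by (auto simp: valid_def)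
  moreover have "\<forall>m j. [m, j] \<in> ones ?d \<longrightarrow> m < length (str c)"
    using c len unfolding valid_def by (metis cond.sel(2) insert_iff)
  ultimately have "valid ?d" using c unfolding valid_def by simp
  then show ?thesis using that[of ?d] by (auto simp: extends_def)
qed

section \<open>The back-and-forth relation\<close>

definition rk_le :: "nat list \<Rightarrow> nat option \<Rightarrow> bool" where
  "rk_le \<tau> \<gamma> \<longleftrightarrow> rk \<tau> \<lhd> \<gamma> \<or> rk \<tau> = \<gamma>"

text \<open>
  The relation under which the forcing of \<open>\<Pi>\<^sup>0\<^sub>\<gamma>\<close> sets is transferred from \<open>a\<close> to \<open>b\<close>. Since no
  \<open>[m]\<close> with \<open>m \<ge> n\<close> has rank below \<open>\<gamma>\<close>, for \<open>\<gamma>' < \<gamma>\<close> only finitely many \<open>[m, k]\<close> with fixed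
  such \<open>m\<close> have rank below \<open>\<gamma>'\<close>; these may be required to be \<open>0\<close> also in conditions of type
  \<open>None\<close>, and this is the reason for admitting infinitely many zeros.
\<close>

definition below :: "nat option \<Rightarrow> cond \<Rightarrow> cond \<Rightarrow> bool" where
  "below \<gamma> a b \<longleftrightarrow> valid a \<and> valid b \<and> str a = str b \<and>
     (\<exists>n. (ctype a = None \<and> ctype b = Some n \<or> ctype a = Some n \<and> ctype b = None) \<and>
        (\<forall>m\<ge>n. \<not> rk [m] \<lhd> \<gamma>)) \<and>
     (\<forall>\<tau>\<in>ones a. rk_le \<tau> \<gamma> \<longrightarrow> \<tau> \<in> ones b) \<and>
     zeros a \<inter> leaves r fs \<subseteq> zeros b \<and>
     (\<forall>\<tau>\<in>tree r fs. rk \<tau> \<lhd> \<gamma> \<longrightarrow> must_zero a \<tau> \<longrightarrow> must_zero b \<tau>)"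

text \<open>\<open>a'\<close> takes over from \<open>b'\<close> the ones of rank at most \<gamma>'
  and the implied zeros of rank below \<gamma>'. Since \<gamma>' is less than \<gamma>, the relation
  between \<open>a\<close> and \<open>b\<close> excludes conflicts.\<close>

lemma below_step:
  assumes ab: "below \<gamma> a b" and \<gamma>': "\<gamma>' \<lhd> \<gamma>" and b': "valid b'" "extends b' b"
  shows "\<exists>a'. valid a' \<and> extends a' a \<and> below \<gamma>' b' a'"
proof -
  obtain n where ct: "ctype a = None \<and> ctype b = Some n \<or> ctype a = Some n \<and> ctype b = None"
    and n: "\<And>m. n \<le> m \<Longrightarrow> \<not> rk [m] \<lhd> \<gamma>"
    using ab by (auto simp: below_def)
  have ct': "ctype b' = ctype b" using b' by (simp add: extends_def)
  have va: "valid a" and vb: "valid b" and str_eq: "str a = str b"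
    and ab_ones: "\<And>\<tau>. \<tau> \<in> ones a \<Longrightarrow> rk_le \<tau> \<gamma> \<Longrightarrow> \<tau> \<in> ones b"
    and ab_zeros: "\<And>\<tau>. \<tau> \<in> tree r fs \<Longrightarrow> rk \<tau> \<lhd> \<gamma> \<Longrightarrow> must_zero a \<tau> \<Longrightarrow> must_zero b \<tau>"
    using ab by (auto simp: below_def)
  have ones_tree: "\<tau> \<in> tree r fs" if "\<tau> \<in> ones a \<or> \<tau> \<in> ones b'" for \<tau>
    using that va b'(1) by (auto simp: valid_def)
  have le_less: "rk \<tau> \<lhd> \<gamma>" if "rk_le \<tau> \<gamma>'" for \<tau>
    using that \<gamma>' less_trans by (auto simp: rk_le_def)
  have leaf_le: "rk_le \<tau> \<gamma>'" if "\<tau> \<in> leaves r fs" for \<tau>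
    using that less_total[of "rk \<tau>" \<gamma>'] less_ords(1)[OF \<gamma>'] rk_ords[of \<tau>]
    unfolding leaves_iff ord_zero_def rk_le_def by blast
  \<comment> \<open>Children of copied ones are implied zeros anyway, and recording them could
    destroy finite branching. Zero leaves are always kept, since \<open>below\<close> demands them
    even for \<gamma>' = 0.\<close>
  define Q where "Q = {\<tau> \<in> tree r fs. must_zero b' \<tau> \<and> rk \<tau> \<lhd> \<gamma>' \<and>
      \<not> (\<exists>\<sigma> k. \<tau> = \<sigma> @ [k] \<and> \<sigma> \<in> ones b' \<and> rk_le \<sigma> \<gamma>')} \<union> (zeros b' \<inter> leaves r fs)"
  define a1 where "a1 = Cond (ctype a) (ones a \<union> {\<tau> \<in> ones b'. rk_le \<tau> \<gamma>'}) (zeros a \<union> Q) (str a)"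
  have mz_a1: "must_zero a \<tau> \<or> must_zero b' \<tau> \<and> rk_le \<tau> \<gamma>'" if "must_zero a1 \<tau>" "\<tau> \<in> tree r fs" for \<tau>
  proof -
    have "must_zero a \<tau>" if "\<tau> \<in> zeros a" using that by (simp add: must_zero_def)
    moreover have "must_zero b' \<tau> \<and> rk_le \<tau> \<gamma>'" if "\<tau> \<in> Q"
      using that leaf_le by (auto simp: Q_def must_zero_def rk_le_def)
    moreover have "must_zero a \<tau>" if "\<tau> = \<sigma> @ [k]" "\<sigma> \<in> ones a" for \<sigma> k
      using that by (auto simp: must_zero_def)
    moreover have "must_zero b' \<tau> \<and> rk_le \<tau> \<gamma>'"
      if "\<tau> = \<sigma> @ [k]" "\<sigma> \<in> ones b'" "rk_le \<sigma> \<gamma>'" for \<sigma> k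
      using that \<open>\<tau> \<in> tree r fs\<close> parent_tree(2)[of \<sigma> k] less_trans
      by (auto simp: must_zero_def rk_le_def)
    moreover have "must_zero a \<tau>" if "ctype a = Some n'" "n' \<le> m" "\<tau> = [m, k]" for n' m k
      using that by (auto simp: must_zero_def)
    moreover have "\<tau> \<in> zeros a \<or> \<tau> \<in> Q \<or> (\<exists>\<sigma> k. \<tau> = \<sigma> @ [k] \<and> \<sigma> \<in> ones a) \<or>
        (\<exists>\<sigma> k. \<tau> = \<sigma> @ [k] \<and> \<sigma> \<in> ones b' \<and> rk_le \<sigma> \<gamma>') \<or>
        (\<exists>n m k. ctype a = Some n \<and> n \<le> m \<and> \<tau> = [m, k])"
      using that(1) unfolding must_zero_def[of a1] by (auto simp: a1_def)
    ultimately show ?thesis by blast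
  qed
  \<comment> \<open>A clash between \<open>a\<close> and \<open>b'\<close> occurs at rank at most
    \<gamma>', hence below \<gamma>; the entry of \<open>a\<close> then passes through
    \<open>b\<close> to \<open>b'\<close>, which would itself be inconsistent.\<close>
  have consistent: "\<not> must_zero a1 \<tau>" if \<tau>: "\<tau> \<in> ones a1" for \<tau>
  proof
    assume "must_zero a1 \<tau>"
    have tr: "\<tau> \<in> tree r fs" using \<tau> ones_tree by (auto simp: a1_def)
    have ab': "must_zero b' \<tau>" if "must_zero a \<tau>" "rk_le \<tau> \<gamma>'"
      using that ab_zeros[OF tr le_less] must_zero_mono[OF b'(2)] by blast
    have ab'': "\<tau> \<in> ones b'" if "\<tau> \<in> ones a" "rk_le \<tau> \<gamma>'"
      using that ab_ones[of \<tau>] le_less[of \<tau>] b'(2) by (auto simp: rk_le_def extends_def)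
    have disj: "\<not> (\<tau> \<in> ones a \<and> must_zero a \<tau>)" "\<not> (\<tau> \<in> ones b' \<and> must_zero b' \<tau>)"
      using va b'(1) by (auto simp: valid_def)
    have "\<tau> \<in> ones a \<or> \<tau> \<in> ones b' \<and> rk_le \<tau> \<gamma>'" using \<tau> by (auto simp: a1_def)
    then show False using mz_a1[OF \<open>must_zero a1 \<tau>\<close> tr] ab' ab'' disj by blast
  qed
  have fin: "finitely_branching (zeros a1)"
    unfolding finitely_branching_def
  proof
    fix \<sigma>
    have fa: "finite {k. \<sigma> @ [k] \<in> zeros a}" and fb: "finite {k. \<sigma> @ [k] \<in> zeros b'}"
      using va b'(1) finitely_branchingD unfolding valid_def by blast+
    let ?F = "{k. \<sigma> @ [k] \<in> tree r fs \<and> rk (\<sigma> @ [k]) \<lhd> \<gamma>'}"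
    have finF: "finite ?F" if "\<sigma> \<in> tree r fs \<longrightarrow> \<gamma>' \<lhd> rk \<sigma>"
    proof (cases "\<sigma> \<in> tree r fs")
      case True
      then have "finite {k. rk (\<sigma> @ [k]) \<lhd> \<gamma>'}" using finite_children_below that by blast
      then show ?thesis by (rule rev_finite_subset) blast
    next
      case False
      then have "?F = {}" using parent_tree(1) by blast
      then show ?thesis by (simp only: finite.emptyI)
    qed
    have big: "\<gamma>' \<lhd> rk \<sigma>" if "\<sigma> \<in> tree r fs" "\<not> rk_le \<sigma> \<gamma>'"
      using that less_total[OF rk_ords[OF that(1)] less_ords(1)[OF \<gamma>']] by (auto simp: rk_le_def)
    \<comment> \<open>Apart from recorded zeros, \<open>Q\<close> has members under \<sigma> only if
      \<sigma> is a one of rank above \<gamma>' or \<sigma> is \<open>[m]\<close> with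
      \<open>n \<le> m\<close>. In both cases \<gamma>' is below the rank of \<sigma>, so only
      finitely many children have rank below \<gamma>'.\<close>
    have "finite {k. \<sigma> @ [k] \<in> Q}"
    proof (cases "\<sigma> \<in> ones b' \<and> \<not> rk_le \<sigma> \<gamma>' \<or> (\<exists>m. \<sigma> = [m] \<and> n \<le> m)")
      case True
      have "\<gamma>' \<lhd> rk [m]" if "n \<le> m" for m
        using n[OF that] \<gamma>' less_trans less_total[of "rk [m]" \<gamma>] less_ords(2)[OF \<gamma>']
          rk_ords[OF level1(1)] by metis
      then have "\<sigma> \<in> tree r fs \<longrightarrow> \<gamma>' \<lhd> rk \<sigma>" using True big by blast
      note finF[OF this]
      moreover have "{k. \<sigma> @ [k] \<in> Q} \<subseteq> ?F \<union> {k. \<sigma> @ [k] \<in> zeros b'}" by (auto simp: Q_def)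
      ultimately show ?thesis using fb finite_subset by blast
    next
      case False
      have "{k. \<sigma> @ [k] \<in> Q} \<subseteq> {k. \<sigma> @ [k] \<in> zeros b'}"
        using False ct ct' unfolding Q_def must_zero_def by auto
      then show ?thesis using fb finite_subset by blast
    qed
    then have "finite ({k. \<sigma> @ [k] \<in> zeros a} \<union> {k. \<sigma> @ [k] \<in> Q})" using fa by blast
    moreover have "{k. \<sigma> @ [k] \<in> zeros a1} = {k. \<sigma> @ [k] \<in> zeros a} \<union> {k. \<sigma> @ [k] \<in> Q}"
      by (auto simp: a1_def)
    ultimately show "finite {k. \<sigma> @ [k] \<in> zeros a1}" by (simp only:)
  qed
  have low: "m < length (str a)" if "[m, k] \<in> ones a1" for m k
  proof (cases "[m, k] \<in> ones a")
    case True
    then show ?thesis using va by (auto simp: valid_def)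
  next
    case False
    then have mk: "[m, k] \<in> ones b'" "rk_le [m, k] \<gamma>'" using that by (auto simp: a1_def)
    \<comment> \<open>Whichever of \<open>a\<close> and \<open>b'\<close> has type
      \<open>Some n\<close> makes \<open>[m, k]\<close> a zero for \<open>n \<le> m\<close>.\<close>
    have "m < n"
    proof (rule ccontr)
      assume "\<not> m < n"
      then have "must_zero a [m, k] \<or> must_zero b' [m, k]"
        using ct ct' by (auto simp: must_zero_def)
      then have "must_zero b' [m, k]"
        using ab_zeros[OF level2 le_less[OF mk(2)]] must_zero_mono[OF b'(2)] by blast
      then show False using mk(1) b'(1) by (auto simp: valid_def)
    qed
    moreover have "n \<le> length (str a)" using ct va vb str_eq by (auto simp: valid_def)
    ultimately show ?thesis by simp
  qed
  have wit: "\<exists>k. least_witness a1 m k"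
    if m: "m < length (str a)" "\<forall>n. ctype a = Some n \<longrightarrow> m < n" for m
  proof -
    obtain k where "least_witness a m k" using valid_witness[OF va m(1)] m(2) by blast
    then show ?thesis using least_witness_mono[of a m k a1] m(1) by (auto simp: a1_def)
  qed
  have "valid a1"
  proof -
    have "finite (ones a1)" "ones a1 \<subseteq> {\<sigma> \<in> tree r fs. 2 \<le> length \<sigma>}"
      using va b'(1) by (auto simp: valid_def a1_def)
    moreover have "ctype a1 = ctype a" "str a1 = str a" by (simp_all add: a1_def)
    moreover have "\<forall>n. ctype a = Some n \<longrightarrow> n \<le> length (str a)" using va by (simp add: valid_def)
    ultimately show ?thesis unfolding valid_def using consistent fin low wit by simp
  qed
  moreover have "prefix (str a1) (str b')" using str_eq b'(2) by (simp add: a1_def extends_def)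
  \<comment> \<open>\<open>below \<gamma>' b' a'\<close> restricts \<open>a'\<close> only by what
    \<open>b'\<close> says, so witnesses added along with the new bits do no harm.\<close>
  ultimately obtain a' where a': "valid a'" "extends a' a1" "str a' = str b'" using extend_str by blast
  have "extends a1 a" by (auto simp: extends_def a1_def)
  then have extends: "extends a' a" using a'(2) extends_trans by blast
  have ones': "\<tau> \<in> ones a'" if "\<tau> \<in> ones b'" "rk_le \<tau> \<gamma>'" for \<tau>
    using that a'(2) by (auto simp: extends_def a1_def)
  have Q': "\<tau> \<in> zeros a'" if "\<tau> \<in> Q" for \<tau>
    using that a'(2) by (auto simp: extends_def a1_def)
  have "must_zero a' \<tau>" if "\<tau> \<in> tree r fs" "rk \<tau> \<lhd> \<gamma>'" "must_zero b' \<tau>" for \<tau>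
  proof (cases "\<exists>\<sigma> k. \<tau> = \<sigma> @ [k] \<and> \<sigma> \<in> ones b' \<and> rk_le \<sigma> \<gamma>'")
    case True
    then show ?thesis using ones' unfolding must_zero_def by blast
  next
    case False
    then have "\<tau> \<in> Q" using that unfolding Q_def by blast
    then show ?thesis using Q' by (simp add: must_zero_def)
  qed
  moreover have "ctype a' = ctype a" using extends by (simp add: extends_def)
  moreover have "zeros b' \<inter> leaves r fs \<subseteq> zeros a'" using Q' by (auto simp: Q_def)
  moreover have "\<not> rk [m] \<lhd> \<gamma>'" if "n \<le> m" for m using n[OF that] \<gamma>' less_trans by blast
  ultimately have "below \<gamma>' b' a'"
    unfolding below_def using a'(1,3) b'(1) ct ct' ones' by auto
  then show ?thesis using a'(1) extends by blast
qed

end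

section \<open>Generic points\<close>

definition point :: "nat list set \<Rightarrow> (nat \<Rightarrow> cond) \<Rightarrow> (nat list \<Rightarrow> bool) \<times> (nat \<Rightarrow> bool)" where
  "point L s = (restrict (\<lambda>\<tau>. \<exists>i. \<tau> \<in> ones (s i)) L, \<lambda>j. \<exists>i. j < length (str (s i)) \<and> str (s i) ! j)"

text \<open>Only leaf labels and bits are seen. As \<open>zeros\<close> may be infinite, this set
  need not be open.\<close>

definition nbhd :: "nat list set \<Rightarrow> cond \<Rightarrow> ((nat list \<Rightarrow> bool) \<times> (nat \<Rightarrow> bool)) set" where
  "nbhd L c = {(x, y). (\<forall>\<tau>\<in>ones c \<inter> L. x \<tau>) \<and> (\<forall>\<tau>\<in>zeros c \<inter> L. \<not> x \<tau>) \<and>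
     (\<forall>j<length (str c). y j = str c ! j)}"

lemma nbhd_antimono: "extends d c \<Longrightarrow> nbhd L d \<subseteq> nbhd L c"
  unfolding nbhd_def extends_def prefix_def by (fastforce simp: nth_append)

context coded_tree
begin

text \<open>The third family makes the recorded labels obey the recursion: an inner node that never
  becomes a one acquires a child that is a one.\<close>

definition basic_sets :: "cond set set" where
  "basic_sets = range (\<lambda>j. {c. j < length (str c)}) \<union>
     range (\<lambda>\<tau>. {c. \<tau> \<in> ones c \<or> \<tau> \<in> zeros c}) \<union>
     (\<lambda>\<sigma>. {c. \<sigma> \<in> ones c \<or> (\<exists>k. \<sigma> @ [k] \<in> ones c)}) `
       {\<sigma> \<in> tree r fs. \<sigma> \<notin> leaves r fs \<and> 2 \<le> length \<sigma>}"

lemma countable_basic_sets: "countable basic_sets"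
  unfolding basic_sets_def by (intro countable_Un countable_image countableI_type)

lemma basic_sets_dense:
  assumes "D \<in> basic_sets" "valid c"
  shows "\<exists>d. valid d \<and> extends d c \<and> d \<in> D"
proof -
  consider (str) j where "D = {c. j < length (str c)}"
    | (decide) \<tau> where "D = {c. \<tau> \<in> ones c \<or> \<tau> \<in> zeros c}"
    | (witness) \<sigma> where "D = {c. \<sigma> \<in> ones c \<or> (\<exists>k. \<sigma> @ [k] \<in> ones c)}"
        "\<sigma> \<in> tree r fs" "\<sigma> \<notin> leaves r fs" "2 \<le> length \<sigma>"
    using assms(1) unfolding basic_sets_def by blast
  then show ?thesis
  proof cases
    case str
    obtain d where "valid d" "extends d c" "str d = str c @ replicate (Suc j) False"
      using extend_str[OF assms(2), of "str c @ replicate (Suc j) False"] by auto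
    then show ?thesis using str by auto
  next
    case decide
    then show ?thesis using extend_decide[OF assms(2), of \<tau>] by blast
  next
    case witness
    then show ?thesis using extend_witness[OF assms(2) witness(2-4)] by blast
  qed
qed

end

section \<open>The point of a generic sequence\<close>

locale generic_sequence = coded_tree +
  fixes s :: "nat \<Rightarrow> cond"
  assumes descending: "valid (s i) \<and> extends (s (Suc i)) (s i)"
    and meets: "D \<in> basic_sets \<Longrightarrow> \<exists>i. \<exists>d\<in>D. extends (s i) d"
begin

abbreviation x where "x \<equiv> fst (point (leaves r fs) s)"
abbreviation y where "y \<equiv> snd (point (leaves r fs) s)"

lemma extends_le: "i \<le> j \<Longrightarrow> extends (s j) (s i)"
  by (induction rule: dec_induct) (use descending in \<open>blast intro: extends_refl extends_trans\<close>)+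

lemma str_unbounded: "\<exists>i. j < length (str (s i))"
proof -
  have "{c. j < length (str c)} \<in> basic_sets" by (auto simp: basic_sets_def)
  from meets[OF this] show ?thesis
    unfolding extends_def by (blast dest: prefix_length_le intro: less_le_trans)
qed

lemma decides: "\<exists>i. \<tau> \<in> ones (s i) \<or> \<tau> \<in> zeros (s i)"
proof -
  have "{c. \<tau> \<in> ones c \<or> \<tau> \<in> zeros c} \<in> basic_sets" by (auto simp: basic_sets_def)
  from meets[OF this] show ?thesis unfolding extends_def by blast
qed

lemma has_witness:
  assumes "\<sigma> \<in> tree r fs" "\<sigma> \<notin> leaves r fs" "2 \<le> length \<sigma>"
  shows "\<exists>i. \<sigma> \<in> ones (s i) \<or> (\<exists>k. \<sigma> @ [k] \<in> ones (s i))"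
proof -
  have "{c. \<sigma> \<in> ones c \<or> (\<exists>k. \<sigma> @ [k] \<in> ones c)} \<in> basic_sets"
    using assms by (auto simp: basic_sets_def)
  from meets[OF this] show ?thesis unfolding extends_def by blast
qed

lemma ones_not_must_zero:
  assumes "\<tau> \<in> ones (s i)"
  shows "\<not> must_zero (s j) \<tau>"
proof
  assume "must_zero (s j) \<tau>"
  then have "must_zero (s (max i j)) \<tau>" using must_zero_mono extends_le max.cobounded2 by blast
  moreover have "\<tau> \<in> ones (s (max i j))" using assms extends_le[of i "max i j"] by (auto simp: extends_def)
  ultimately show False using descending[of "max i j"] by (auto simp: valid_def)
qed

lemma ctype_eq: "ctype (s i) = ctype (s 0)"
  using extends_le[of 0 i] by (simp add: extends_def)

lemma y_nth:
  assumes "j < length (str (s i))"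
  shows "y j = str (s i) ! j"
proof -
  have "str (s i') ! j = str (s i) ! j" if "j < length (str (s i'))" for i'
    using assms that extends_le[of i i'] extends_le[of i' i]
    by (cases "i \<le> i'") (auto simp: extends_def prefix_def nth_append)
  then show ?thesis using assms unfolding point_def snd_conv by metis
qed

lemma restr_y: "j \<le> length (str (s i)) \<Longrightarrow> restr y j = take j (str (s i))"
  unfolding restr_def by (rule nth_equalityI) (auto simp: y_nth[of _ i])

lemma x_leaf: "\<tau> \<in> leaves r fs \<Longrightarrow> x \<tau> \<longleftrightarrow> (\<exists>i. \<tau> \<in> ones (s i))"
  by (simp add: point_def)

text \<open>Induction from the leaves: children of a one are never ones, and a node that never
  becomes a one gets a child that does by \<open>has_witness\<close>.\<close>

lemma label_iff:
  assumes "\<tau> \<in> tree r fs" "2 \<le> length \<tau>"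
  shows "label r fs x \<tau> \<longleftrightarrow> (\<exists>i. \<tau> \<in> ones (s i))"
  using assms
proof (induction \<tau> rule: wf_induct_rule[OF wf_child_rel[OF well_order fund]])
  case (1 \<tau>)
  show ?case
  proof (cases "\<tau> \<in> leaves r fs")
    case True
    then show ?thesis using label_leaf[OF well_order fund True] x_leaf by simp
  next
    case False
    have child: "label r fs x (\<tau> @ [k]) \<longleftrightarrow> (\<exists>i. \<tau> @ [k] \<in> ones (s i))" for k
    proof (rule "1.IH")
      show "\<tau> @ [k] \<in> tree r fs" using child_tree 1 False by blast
      then show "(\<tau> @ [k], \<tau>) \<in> child_rel r fs" using 1 by (auto simp: child_rel_def)
    qed (use 1 in simp)
    have "\<not> (\<tau> \<in> ones (s i) \<and> \<tau> @ [k] \<in> ones (s j))" for i j k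
      using ones_not_must_zero[of "\<tau> @ [k]" j i] by (auto simp: must_zero_def)
    then have "(\<exists>i. \<tau> \<in> ones (s i)) \<longleftrightarrow> \<not> (\<exists>k i. \<tau> @ [k] \<in> ones (s i))"
      using has_witness[OF 1(2) False 1(3)] by blast
    then show ?thesis using label_inner[OF well_order fund 1(2) False, of x] child by auto
  qed
qed

lemma witness_below:
  assumes "\<And>n. ctype (s 0) = Some n \<Longrightarrow> m < n"
  obtains k i where "m < length (str (s i))" "least_witness (s i) m k"
proof -
  obtain i where i: "m < length (str (s i))" using str_unbounded by blast
  have "valid (s i)" using descending by blast
  from valid_witness[OF this i] show ?thesis using assms ctype_eq[of i] i that by auto
qed

text \<open>For \<open>n \<le> m\<close> all \<open>[m, k]\<close> are implied zeros, which gives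
  \<open>[m]\<close> the label 1; otherwise a least witness gives it the label 0.\<close>

lemma label_level1: "label r fs x [m] \<longleftrightarrow> (\<exists>n. ctype (s 0) = Some n \<and> n \<le> m)"
proof -
  have "label r fs x ([m] @ [k]) \<longleftrightarrow> (\<exists>i. [m, k] \<in> ones (s i))" for k
    using label_iff[OF level2, of m k] by simp
  then have lab: "label r fs x [m] \<longleftrightarrow> \<not> (\<exists>k i. [m, k] \<in> ones (s i))"
    using label_inner[OF well_order fund level1, of x m] by auto
  show ?thesis
  proof (cases "\<exists>n. ctype (s 0) = Some n \<and> n \<le> m")
    case True
    then have "must_zero (s 0) [m, k]" for k by (auto simp: must_zero_def)
    then show ?thesis using lab True ones_not_must_zero by blast
  next
    case False
    then have "ctype (s 0) = Some n \<Longrightarrow> m < n" for n by (meson not_le)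
    then obtain k i where "least_witness (s i) m k" by (rule witness_below)
    then show ?thesis using lab False unfolding least_witness_def by blast
  qed
qed

lemma n_sup_eq: "n_sup r fs x = (case ctype (s 0) of None \<Rightarrow> \<infinity> | Some n \<Rightarrow> enat n)"
proof (cases "ctype (s 0)")
  case None
  have "infinite (range enat)" by (simp add: finite_image_iff inj_def)
  then show ?thesis using None by (simp add: n_sup_def label_level1 Sup_enat_def)
next
  case (Some n)
  \<comment> \<open>The set contains \<open>n\<close> itself, as only \<open>m < n\<close> are
    tested there; so the supremum is \<open>n\<close>.\<close>
  have "{l. \<forall>m<l. \<not> n \<le> m} = {..n}" 
  proof
    show "{l. \<forall>m<l. \<not> n \<le> m} \<subseteq> {..n}" by (auto simp: not_le intro: leI)
  qed auto
  moreover have "Sup (enat ` {..n}) = enat n" by (intro antisym Sup_least Sup_upper) auto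
  ultimately show ?thesis using Some by (simp add: n_sup_def label_level1)
qed

text \<open>The recorded witness is the true least one, since all smaller candidates are recorded
  zeros, and it codes the first \<open>m + 1\<close> bits of the condition, which are those of
  \<open>y\<close>.\<close>

lemma point_in_W: "point (leaves r fs) s \<in> set_W r fs M"
proof -
  have "codes M (k_least r fs x m) (restr y (m + 1))" if m: "enat m < n_sup r fs x" for m
  proof -
    have "ctype (s 0) = Some n \<Longrightarrow> m < n" for n using m by (simp add: n_sup_eq)
    then obtain k i where ki: "m < length (str (s i))" "least_witness (s i) m k"
      by (rule witness_below)
    have "k_least r fs x m = k"
      unfolding k_least_def
    proof (rule Least_equality)
      show "label r fs x [m, k] = True"
        using label_iff[OF level2, of m k] ki(2) by (auto simp: least_witness_def)
      fix k' assume "label r fs x [m, k'] = True"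
      then obtain j where j: "[m, k'] \<in> ones (s j)" using label_iff[OF level2, of m k'] by auto
      show "k \<le> k'"
      proof (rule ccontr)
        assume "\<not> k \<le> k'"
        then have "must_zero (s i) [m, k']" using ki(2) by (simp add: must_zero_def least_witness_def)
        then show False using ones_not_must_zero[OF j] by blast
      qed
    qed
    then show ?thesis using ki restr_y[of "Suc m" i] by (simp add: least_witness_def)
  qed
  moreover have "point (leaves r fs) s \<in> topspace (space_X r fs)"
    by (auto simp: space_X_def cantor_space_def point_def)
  ultimately show ?thesis unfolding set_W_def by (auto simp: case_prod_unfold)
qed

lemma point_in_nbhd: "point (leaves r fs) s \<in> nbhd (leaves r fs) (s i)"
proof -
  have "\<not> x \<tau>" if "\<tau> \<in> zeros (s i)" "\<tau> \<in> leaves r fs" for \<tau>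
    using that ones_not_must_zero[of \<tau> _ i] x_leaf[of \<tau>] by (auto simp: must_zero_def)
  moreover have "x \<tau>" if "\<tau> \<in> ones (s i)" "\<tau> \<in> leaves r fs" for \<tau>
    using that x_leaf by blast
  ultimately show ?thesis unfolding nbhd_def using y_nth[of _ i] by (simp add: case_prod_unfold)
qed

text \<open>A basic open box restricts finitely many leaves and bits; a late stage \<open>i\<close>
  has decided all of these.\<close>

lemma nbhd_base:
  assumes "openin (space_W r fs M) U" "point (leaves r fs) s \<in> U"
  shows "\<exists>i. nbhd (leaves r fs) (s i) \<inter> topspace (space_W r fs M) \<subseteq> U"
proof -
  let ?L = "leaves r fs"
  obtain V where V: "openin (space_X r fs) V" "U = V \<inter> set_W r fs M"
    using assms(1) by (auto simp: space_W_def openin_subtopology)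
  have "(x, y) \<in> V" using assms(2) V(2) by simp
  then obtain A B where A: "openin (product_topology (\<lambda>_. discrete_topology UNIV) ?L) A" "x \<in> A"
    and B: "openin cantor_space B" "y \<in> B" and AB: "A \<times> B \<subseteq> V"
    using V(1) unfolding space_X_def openin_prod_topology_alt by metis
  obtain A' where A': "finite {i \<in> ?L. A' i \<noteq> UNIV}" "x \<in> Pi\<^sub>E ?L A'" "Pi\<^sub>E ?L A' \<subseteq> A"
    using A unfolding openin_product_topology_alt by (auto simp del: PiE_UNIV_domain)
  obtain B' where B': "finite {i. B' i \<noteq> UNIV}" "y \<in> Pi\<^sub>E UNIV B'" "Pi\<^sub>E UNIV B' \<subseteq> B"
    using B unfolding cantor_space_def openin_product_topology_alt by (auto simp del: PiE_UNIV_domain)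
  let ?F = "{i \<in> ?L. A' i \<noteq> UNIV}"
  obtain f where f: "\<And>\<tau>. \<tau> \<in> ones (s (f \<tau>)) \<or> \<tau> \<in> zeros (s (f \<tau>))" using decides by metis
  obtain b where b: "\<And>j. B' j \<noteq> UNIV \<Longrightarrow> j < b"
    using B'(1) by (metis (mono_tags, lifting) finite_nat_set_iff_bounded mem_Collect_eq)
  obtain i0 where i0: "b < length (str (s i0))" using str_unbounded by blast
  define i where "i = Max (insert i0 (f ` ?F))"
  have le: "i0 \<le> i" "\<And>\<tau>. \<tau> \<in> ?F \<Longrightarrow> f \<tau> \<le> i" using A'(1) by (auto simp: i_def intro: Max_ge)
  have len: "b < length (str (s i))"
    using i0 extends_le[OF le(1)] by (auto simp: extends_def dest: prefix_length_le)
  have "(x', y') \<in> U"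
    if nb: "(x', y') \<in> nbhd ?L (s i)" and W: "(x', y') \<in> topspace (space_W r fs M)" for x' y'
  proof -
    have in_W: "(x', y') \<in> set_W r fs M" and top: "(x', y') \<in> topspace (space_X r fs)"
      using W by (auto simp: space_W_def)
    have "x' \<tau> \<in> A' \<tau>" if "\<tau> \<in> ?L" for \<tau>
    proof (cases "\<tau> \<in> ?F")
      case True
      have "\<tau> \<in> ones (s i) \<or> \<tau> \<in> zeros (s i)"
        using f[of \<tau>] extends_le[OF le(2)[OF True]] by (auto simp: extends_def)
      then have "x' \<tau> = x \<tau>" using that nb point_in_nbhd[of i] by (auto simp: nbhd_def)
      then show ?thesis using A'(2) that by (auto simp: PiE_iff)
    next
      case False
      then show ?thesis using that by auto
    qed
    moreover have "x' \<in> extensional ?L" using top by (auto simp: space_X_def PiE_iff)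
    ultimately have "x' \<in> Pi\<^sub>E ?L A'" by (simp add: PiE_iff)
    then have "x' \<in> A" using A'(3) by blast
    have "y' j \<in> B' j" for j
    proof (cases "B' j = UNIV")
      case False
      then have "y' j = y j" using b[of j] len nb y_nth[of j i] by (auto simp: nbhd_def)
      then show ?thesis using B'(2) by (auto simp: PiE_iff)
    qed simp
    then have "y' \<in> B" using B'(3) by (auto simp: PiE_iff)
    then show ?thesis using \<open>x' \<in> A\<close> AB V(2) in_W by blast
  qed
  then show ?thesis by (intro exI[of _ i]) auto
qed

end

context coded_tree
begin

sublocale generic_points "Collect valid" extends basic_sets "point (leaves r fs)" "nbhd (leaves r fs)"
  "space_W r fs M"
proof
  fix s :: "nat \<Rightarrow> cond" and U
  assume "\<And>i. s i \<in> Collect valid \<and> extends (s (Suc i)) (s i)"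
    and "\<And>D. D \<in> basic_sets \<Longrightarrow> \<exists>i. \<exists>d\<in>D. extends (s i) d"
  then interpret generic_sequence r fs M s by unfold_locales auto
  have "set_W r fs M \<subseteq> topspace (space_X r fs)" by (auto simp: set_W_def)
  then show "point (leaves r fs) s \<in> topspace (space_W r fs M)"
    using point_in_W by (auto simp: space_W_def)
  show "point (leaves r fs) s \<in> nbhd (leaves r fs) (s i)" for i by (rule point_in_nbhd)
  show "openin (space_W r fs M) U \<Longrightarrow> point (leaves r fs) s \<in> U \<Longrightarrow>
    \<exists>i. nbhd (leaves r fs) (s i) \<inter> topspace (space_W r fs M) \<subseteq> U"
    by (rule nbhd_base)
qed (use extends_refl extends_trans countable_basic_sets basic_sets_dense nbhd_antimono in blast)+


section \<open>Edges between generic points\<close>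

text \<open>
  For points of type \<open>Some n\<close> the bit \<open>y(n)\<close> is unconstrained, so that switching it is an
  automorphism of the conditions; it carries generic points to their neighbours in the graph.
\<close>

definition flip :: "nat \<Rightarrow> cond \<Rightarrow> cond" where
  "flip n c = (if ctype c = Some n
     then Cond (Some n) (ones c) (zeros c) ((str c)[n := \<not> str c ! n]) else c)"

lemma flip_simps [simp]:
  "ctype (flip n c) = ctype c" "ones (flip n c) = ones c" "zeros (flip n c) = zeros c"
  "length (str (flip n c)) = length (str c)"
  by (simp_all add: flip_def)

lemma flip_flip: "flip n (flip n c) = c"
proof (cases "ctype c = Some n \<and> n < length (str c)")
  case True
  then show ?thesis by (cases c) (simp add: flip_def)
next
  case False
  then show ?thesis by (cases c) (auto simp: flip_def list_update_beyond not_less)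
qed

lemma flip_extends:
  assumes "extends d c"
  shows "extends (flip n d) (flip n c)"
proof -
  obtain zs where zs: "str d = str c @ zs" using assms by (auto simp: extends_def prefix_def)
  have "prefix ((str c)[n := \<not> str c ! n]) ((str d)[n := \<not> str d ! n])"
    by (cases "n < length (str c)") (auto simp: zs list_update_append nth_append list_update_beyond not_less)
  then show ?thesis using assms by (simp add: extends_def flip_def)
qed

lemma valid_flip:
  assumes "valid c"
  shows "valid (flip n c)"
proof (cases "ctype c = Some n")
  case True
  have mz: "must_zero (flip n c) = must_zero c" by (rule ext) (simp add: must_zero_def)
  \<comment> \<open>The witness for \<open>m < n\<close> codes only bits up to \<open>m\<close>, so
    bit \<open>n\<close> is not read.\<close>
  have "least_witness (flip n c) m k" if "m < n" "least_witness c m k" for m k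
    using that True by (simp add: least_witness_def flip_def take_update_cancel)
  then show ?thesis using assms True unfolding valid_def mz by (simp; metis)
next
  case False
  then show ?thesis using assms by (simp add: flip_def)
qed

lemma forces_edge:
  assumes q: "valid q" "ctype q = Some n" "length (str q) = n" and B: "forces q B"
  obtains u v where "u \<in> B" "v \<in> B" "(u, v) \<in> graph_L r fs M"
proof -
  obtain \<D> where \<D>: "admissible \<D>"
    "\<And>s i. generic \<D> s \<Longrightarrow> extends (s i) q \<Longrightarrow> point (leaves r fs) s \<in> B"
    using B by (auto simp: forces_def)
  \<comment> \<open>Meeting the flipped copies of the dense sets makes the flipped sequence
    \<open>t\<close> generic for \<open>\<D>\<close> as well.\<close>
  define \<F> where "\<F> = (\<lambda>D. flip n ` (D \<inter> Collect valid)) ` \<D>"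
  have "dense_conditions (flip n ` (D \<inter> Collect valid))" if "D \<in> \<D>" for D
    unfolding dense_conditions_def
  proof
    fix c assume "c \<in> Collect valid"
    then have "flip n c \<in> Collect valid" by (simp add: valid_flip)
    moreover have "dense_conditions D" using \<D>(1) that by (simp add: admissible_def)
    ultimately obtain d where d: "valid d" "extends d (flip n c)" "d \<in> D"
      unfolding dense_conditions_def by blast
    have "extends (flip n d) c" using flip_extends[OF d(2), of n] by (simp add: flip_flip)
    then show "\<exists>e\<in>Collect valid. extends e c \<and> e \<in> flip n ` (D \<inter> Collect valid)"
      using d valid_flip by blast
  qed
  then have adm: "admissible (\<D> \<union> \<F>)" using \<D>(1) by (auto simp: admissible_def \<F>_def)
  \<comment> \<open>Since \<open>str q\<close> has length \<open>n\<close>, the appended bit is bit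
    \<open>n\<close>; it is \<open>False\<close> because an edge starts at a point with
    \<open>n \<notin> y\<close>.\<close>
  let ?q = "Cond (Some n) (ones q) (zeros q) (str q @ [False])"
  have vq: "valid ?q" "extends ?q q" using extend_Some[OF q(1,2)] by blast+
  obtain s where s: "generic (\<D> \<union> \<F>) s" "s 0 = ?q" using generic_exists[OF adm, of ?q] vq(1) by auto
  define t where "t = flip n \<circ> s"
  have gs: "generic \<D> s" using s(1) generic_mono by blast
  have gt: "generic \<D> t"
    unfolding generic_def
  proof (intro conjI allI ballI)
    show "t i \<in> Collect valid" "extends (t (Suc i)) (t i)" for i
      using s(1) by (auto simp: generic_def t_def intro: valid_flip flip_extends)
    fix D assume "D \<in> \<D>"
    then have "flip n ` (D \<inter> Collect valid) \<in> \<D> \<union> \<F>" by (auto simp: \<F>_def)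
    then have "\<exists>i. \<exists>e\<in>flip n ` (D \<inter> Collect valid). extends (s i) e"
      using s(1) by (auto simp only: generic_def)
    then obtain i d where d: "extends (s i) (flip n d)" "d \<in> D" by (elim exE bexE imageE IntE) simp
    have "extends (t i) d" using flip_extends[OF d(1), of n] by (simp add: flip_flip t_def)
    then show "\<exists>i. \<exists>d\<in>D. extends (t i) d" using d(2) by blast
  qed
  have basic: "basic_sets \<subseteq> \<D>" using \<D>(1) by (simp add: admissible_def)
  interpret S: generic_sequence r fs M s
    using gs basic unfolding generic_def by unfold_locales auto
  interpret T: generic_sequence r fs M t
    using gt basic unfolding generic_def by unfold_locales auto
  let ?u = "point (leaves r fs) s" and ?v = "point (leaves r fs) t"
  have t0: "str (t 0) = str q @ [True]" using s(2) q by (simp add: t_def flip_def nth_append list_update_append)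
  have ty: "ctype (s i) = Some n" for i using S.ctype_eq[of i] s(2) by simp
  have "extends (t 0) q" using s(2) q t0 by (auto simp: extends_def t_def)
  then have uv_B: "?u \<in> B" "?v \<in> B" using \<D>(2)[OF gs, of 0] \<D>(2)[OF gt, of 0] vq(2) s(2) by auto
  have x_eq: "fst ?v = fst ?u" by (simp add: point_def t_def)
  have y_n: "\<not> snd ?u n" "snd ?v n"
    using S.y_nth[of n 0] T.y_nth[of n 0] s(2) t0 q(3) by (auto simp: nth_append)
  have y_eq: "snd ?v j = snd ?u j" if "j \<noteq> n" for j
  proof -
    obtain i where i: "j < length (str (s i))" using S.str_unbounded by blast
    have "str (t i) ! j = str (s i) ! j" using that by (simp add: t_def flip_def)
    then show ?thesis using S.y_nth[OF i] T.y_nth[of j i] i by (simp add: t_def)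
  qed
  have "label r fs S.x [n]" using S.label_level1 ty by simp
  then have "\<not> label r fs S.x []"
    using label_inner[OF well_order fund root_tree(1) root_not_leaf, of S.x] by auto
  moreover have "n_sup r fs S.x = enat n" using S.n_sup_eq ty by simp
  moreover have "sym_diff {i. snd ?u i} {i. snd ?v i} = {n}" using y_n y_eq by auto
  moreover have "?u \<in> set_W r fs M" "?v \<in> set_W r fs M" using S.point_in_W T.point_in_W by auto
  moreover from this have "?u \<in> topspace (space_X r fs)" "?v \<in> topspace (space_X r fs)"
    by (auto simp: set_W_def)
  ultimately have "(?u, ?v) \<in> graph_L r fs M"
    unfolding graph_L_def graph_K_def using x_eq y_n(1) by (auto simp: case_prod_unfold)
  then show ?thesis using that uv_B by blast
qed

section \<open>From a colouring to an edge inside one class\<close>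

lemma below_zero: "ord_zero r \<gamma> \<Longrightarrow> below \<gamma> a b \<Longrightarrow> nbhd (leaves r fs) b \<subseteq> nbhd (leaves r fs) a"
proof -
  assume \<gamma>: "ord_zero r \<gamma>" and ab: "below \<gamma> a b"
  \<comment> \<open>Leaves have rank 0, so at this stage the relation compares everything that
    \<open>nbhd\<close> sees.\<close>
  have "rk_le \<tau> \<gamma>" if "\<tau> \<in> leaves r fs" for \<tau>
    using that \<gamma> less_total[of "rk \<tau>" \<gamma>] unfolding leaves_iff ord_zero_def rk_le_def by blast
  then have "ones a \<inter> leaves r fs \<subseteq> ones b" "zeros a \<inter> leaves r fs \<subseteq> zeros b" "str a = str b"
    using ab by (auto simp: below_def)
  then show ?thesis unfolding nbhd_def by auto
qed

text \<open>Rules out \<alpha> = 1, so no colour class arises from the rule \<open>open\<close>;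
  each is a union of sets of lower classes. The reason is that children of the root are not
  leaves.\<close>

lemma top_not_successor_of_zero:
  assumes "ord_succ r \<beta> None"
  shows "\<not> ord_zero r \<beta>"
proof (cases rule: child_cases[OF root_tree(1) root_not_leaf])
  case 1
  then show ?thesis using assms by (auto simp: root_tree ord_limit_def)
next
  case (2 \<gamma>)
  then have "rk [0] = \<beta>" using ord_succ_unique[OF well_order assms] 2(2)[of 0]
    by (simp add: root_tree)
  then show ?thesis using level1[of 0] by (simp add: leaves_iff)
qed

lemma forces_Pi_edge:
  assumes p: "valid p" "ctype p = None" and B: "forces p B" "B \<subseteq> topspace (space_W r fs M)"
    and \<beta>: "(\<beta>, None) \<in> olt r" "Sigma0 r (space_W r fs M) \<beta> (topspace (space_W r fs M) - B)"
  obtains u v where "u \<in> B" "v \<in> B" "(u, v) \<in> graph_L r fs M"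
proof -
  let ?X = "topspace (space_W r fs M)"
  obtain n0 where n0: "\<And>m. n0 \<le> m \<Longrightarrow> \<not> rk [m] \<lhd> \<beta>" using level1_rank_unbounded[OF \<beta>(1)] by blast
  \<comment> \<open>Appending \<open>n0\<close> bits makes the length, which becomes
    \<open>n\<close>, at least \<open>n0\<close>.\<close>
  obtain c where c: "valid c" "extends c p" "str c = str p @ replicate n0 False"
    using extend_str[OF p(1), of "str p @ replicate n0 False"] by auto
  define n where "n = length (str c)"
  \<comment> \<open>The same data with type \<open>Some n\<close>. This is consistent because every
    one \<open>[m, k]\<close> of \<open>c\<close> has \<open>m\<close> below the length
    \<open>n\<close>.\<close>
  define q where "q = Cond (Some n) (ones c) (zeros c) (str c)"
  have ct: "ctype c = None" using c(2) p(2) by (simp add: extends_def)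
  have "\<not> must_zero q \<tau>" if "\<tau> \<in> ones c" for \<tau>
    using c(1) that unfolding valid_def must_zero_def q_def n_def
    by simp (metis leD)
  moreover have "\<exists>k. least_witness q m k" if m: "m < n" for m
  proof -
    obtain k where "least_witness c m k" using valid_witness[OF c(1)] m ct by (auto simp: n_def)
    then show ?thesis by (auto simp: least_witness_def q_def)
  qed
  ultimately have q: "valid q" using c(1) unfolding valid_def by (simp add: q_def n_def)
  have "must_zero q \<tau>" if "must_zero c \<tau>" for \<tau>
    using that ct by (auto simp: must_zero_def q_def)
  then have below_cq: "below \<beta> c q"
    unfolding below_def using c q ct n0 by (auto simp: q_def n_def)
  have forces_c: "forces c (?X - (?X - B))"
    using forces_antimono[OF B(1) c(2)] B(2) by (simp add: double_diff)
  have "forces q (?X - (?X - B))"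
  proof (rule forces_transfer[of r below \<beta> "?X - B" c q])
    show "nbhd (leaves r fs) b \<subseteq> nbhd (leaves r fs) a" if "ord_zero r \<gamma>" "below \<gamma> a b" for \<gamma> a b
      using that by (rule below_zero)
    show "\<exists>a'\<in>Collect valid. extends a' a \<and> below \<gamma>' b' a'"
      if "below \<gamma> a b" "\<gamma>' \<lhd> \<gamma>" "b' \<in> Collect valid" "extends b' b" for \<gamma> \<gamma>' a b b'
      using below_step[OF that(1,2) _ that(4)] that(3) by auto
  qed (use \<beta>(2) c(1) q below_cq forces_c in auto)
  then have "forces q B" using B(2) by (simp add: double_diff)
  then show ?thesis using forces_edge[OF q, of n B] that by (auto simp: q_def n_def)
qed

lemma no_colouring: "\<not> countable_Sigma0_colouring r None (space_W r fs M) (graph_L r fs M) \<A>"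
proof
  let ?X = "topspace (space_W r fs M)"
  assume col: "countable_Sigma0_colouring r None (space_W r fs M) (graph_L r fs M) \<A>"
  then have \<A>: "countable \<A>" "\<Union>\<A> = ?X" "\<And>A. A \<in> \<A> \<Longrightarrow> Sigma0 r (space_W r fs M) None A"
    by (auto simp: countable_Sigma0_colouring_def partition_on_def)
  have indep: "\<not> (u \<in> A \<and> v \<in> A)" if "A \<in> \<A>" "(u, v) \<in> graph_L r fs M" for A u v
    using col that unfolding countable_Sigma0_colouring_def by blast
  \<comment> \<open>The empty condition of type \<open>None\<close> forces the whole space, hence
    the union of the colour classes; all its extensions keep this type.\<close>
  let ?p = "Cond None {} {} []"
  have "valid ?p" by (simp add: valid_def finitely_branching_def)
  moreover have "forces ?p (\<Union>\<A>)" using forces_topspace \<A>(2) by simp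
  ultimately obtain p A where p: "valid p" "extends p ?p" "A \<in> \<A>" "forces p A"
    using forces_UnionD[OF \<A>(1) decided_Sigma0[OF \<A>(3)], of ?p] by auto
  from \<A>(3)[OF p(3)] show False
  proof cases
    case ("open" \<beta>)
    then show False using top_not_successor_of_zero by blast
  next
    case (union B)
    have "decided (B i)" for i using union(2) decided_Sigma0 decided_compl by meson
    then obtain q i where q: "valid q" "extends q p" "forces q (B i)"
      using forces_UnionD[of "range B" p] p(1,4) union(1) by auto
    obtain \<beta> where \<beta>: "(\<beta>, None) \<in> olt r" "Sigma0 r (space_W r fs M) \<beta> (?X - B i)" "B i \<subseteq> ?X"
      using union(2) by blast
    have "ctype q = None" using q(2) p(2) by (simp add: extends_def)
    then obtain u v where "u \<in> B i" "v \<in> B i" "(u, v) \<in> graph_L r fs M"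
      using forces_Pi_edge[OF q(1) _ q(3) \<beta>(3,1,2)] by blast
    then show False using indep[OF p(3)] union(1) by blast
  qed
qed

end

lemma natLeq_on_3_two_elements:
  assumes "(natLeq_on 3, r) \<in> ordLeq"
  shows "\<exists>a\<in>Field r. \<exists>b\<in>Field r. a \<noteq> b"
proof -
  obtain f where f: "embed (natLeq_on 3) r f" and wo: "Well_order (natLeq_on 3)" "Well_order r"
    using assms by (auto simp: ordLeq_def)
  have "inj_on f (Field (natLeq_on 3))" "f ` Field (natLeq_on 3) \<subseteq> Field r"
    using embed_inj_on[OF wo(1) f] embed_Field[OF f] by auto
  moreover have "Field (natLeq_on 3) = {x. x < 3}" by (rule Field_natLeq_on)
  ultimately have "f 0 \<in> Field r" "f 1 \<in> Field r" "f 0 \<noteq> f 1"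
    using inj_on_eq_iff[of f "{x. x < 3}" 0 1] by auto
  then show ?thesis by blast
qed

theorem theorem4p17:
  fixes \<alpha> :: "nat rel"
    and fs :: "nat option \<Rightarrow> nat \<Rightarrow> nat"
    and M :: "nat \<Rightarrow> nat \<Rightarrow> bool"
  assumes "computable_ordinal \<alpha>"
    and "(natLeq_on 3, \<alpha>) \<in> ordLeq"
    and "fundamental_sequences \<alpha> fs"
    and "uniformly_computable M"
    and "dense_list M"
  shows "\<not> (\<exists>P. countable_Sigma0_colouring \<alpha> None (space_W \<alpha> fs M) (graph_L \<alpha> fs M) P)"
proof -
  interpret coded_tree \<alpha> fs M
    using assms natLeq_on_3_two_elements by unfold_locales (auto simp: computable_ordinal_def)
  show ?thesis using no_colouring by blast
qed

end
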